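(* For every $k\ge 3$, the clique query $$K_k = \bigwedge_{1\le i<j\le k} S_{i,j}(x_i,x_j),$$ on input in which all relations have the same size $M$ in bits, can be computed by an MPC algorithm with $p$ servers in $k-1$ rounds with load $\tilde{O}\big(M/p^{2/k}\big)$.
   Context: The query asks for all tuples $(x_1,\dots,x_k)$ satisfying all $\binom{k}{2}$ distinct binary relations (natural join). All relations have $m$ tuples over a domain $[n]$ and size $M=2m\log n$ bits. MPC model. There are $p$ servers connected by a complete network of private channels. Computation proceeds in synchronous rounds, each consisting of a communication phase (servers exchange data) and a computation phase (unrestricted local computation). The input is initially partitioned evenly among the $p$ servers. At the end, the union of the outputs of the servers must be the full set of answers to the query. The load is the maximum number of bits received by any server during any round. Conventions. $k$ is fixed (constants may depend on it). $\tilde O$ hides factors polylogarithmic in $p$. Algorithms may use randomness (random hash functions), and the load bound holds with high probability (probability tending to $1$ as $p\to\infty$, uniformly over inputs). Data statistics, namely relation sizes and information about heavy hitters (values, or tuples of values, of high frequency in a relation, with their frequencies), are available to the servers. Relation sizes are large compared with $p$ ($m\ge p^{c}$ for a suitable constant $c$ depending only on the query). There is no other assumption on the data distribution. *)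

theory Defs
  imports "HOL-Probability.Probability"
begin

section \<open>Massively parallel computation\<close>

text \<open>
  Local computation is unrestricted, so a server may be assumed to remember everything it has ever
  seen.  Its state is therefore its \<^emph>\<open>view\<close>: its own identity, the publicly known number of servers
  and data statistics, the random seed (an encoding of the random hash functions, which all servers
  share), its fragment of the input, and one entry per completed round giving the message received
  from each server.  Messages are bit strings.
\<close>

record ('q, 'a) view =
  self :: nat
  num_servers :: nat
  statistics :: 'q
  seed :: nat
  fragment :: "'a set"
  inbox :: "(nat \<Rightarrow> bool list) list"

text \<open>
  \<^term>\<open>randomness A p q\<close> is the distribution of the seed; it may depend only on public information.
  \<^term>\<open>send A v t\<close> is the message that a server with view \<^term>\<open>v\<close> sends to server \<^term>\<open>t\<close>.
\<close>

record ('q, 'a, 'b) mpc_algorithm =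
  randomness :: "nat \<Rightarrow> 'q \<Rightarrow> nat pmf"
  send :: "('q, 'a) view \<Rightarrow> nat \<Rightarrow> bool list"
  result :: "('q, 'a) view \<Rightarrow> 'b set"

text \<open>The view of server \<^term>\<open>s\<close> after \<^term>\<open>r\<close> rounds, on the input fragments \<^term>\<open>D\<close>;
  the servers are \<^term>\<open>{..<p}\<close>.\<close>

primrec view_after ::
  "('q, 'a, 'b) mpc_algorithm \<Rightarrow> nat \<Rightarrow> 'q \<Rightarrow> (nat \<Rightarrow> 'a set) \<Rightarrow> nat \<Rightarrow> nat \<Rightarrow> nat \<Rightarrow> ('q, 'a) view"
where
  "view_after A p q D \<omega> 0 s =
     \<lparr>self = s, num_servers = p, statistics = q, seed = \<omega>, fragment = D s, inbox = []\<rparr>"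
| "view_after A p q D \<omega> (Suc r) s =
     (view_after A p q D \<omega> r s)
       \<lparr>inbox := inbox (view_after A p q D \<omega> r s)
                 @ [\<lambda>t. if t < p then send A (view_after A p q D \<omega> r t) s else []]\<rparr>"

definition bits_received ::
  "('q, 'a, 'b) mpc_algorithm \<Rightarrow> nat \<Rightarrow> 'q \<Rightarrow> (nat \<Rightarrow> 'a set) \<Rightarrow> nat \<Rightarrow> nat \<Rightarrow> nat \<Rightarrow> nat"
where
  "bits_received A p q D \<omega> r s = (\<Sum>t<p. length (send A (view_after A p q D \<omega> r t) s))"

definition load ::
  "('q, 'a, 'b) mpc_algorithm \<Rightarrow> nat \<Rightarrow> 'q \<Rightarrow> (nat \<Rightarrow> 'a set) \<Rightarrow> nat \<Rightarrow> nat \<Rightarrow> nat"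
where
  "load A p q D \<omega> rounds = Max {bits_received A p q D \<omega> r s | r s. r < rounds \<and> s < p}"

definition union_of_outputs ::
  "('q, 'a, 'b) mpc_algorithm \<Rightarrow> nat \<Rightarrow> 'q \<Rightarrow> (nat \<Rightarrow> 'a set) \<Rightarrow> nat \<Rightarrow> nat \<Rightarrow> 'b set"
where
  "union_of_outputs A p q D \<omega> rounds = (\<Union>s<p. result A (view_after A p q D \<omega> rounds s))"

definition evenly_partitioned :: "nat \<Rightarrow> 'a set \<Rightarrow> (nat \<Rightarrow> 'a set) \<Rightarrow> bool"
where
  "evenly_partitioned p X D \<longleftrightarrow>
     disjoint_family_on D {..<p} \<and> (\<Union>s<p. D s) = X \<and>
     (\<forall>s<p. \<forall>t<p. card (D s) \<le> card (D t) + 1)"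


section \<open>The clique query\<close>

text \<open>\<^term>\<open>S i j\<close>, for \<^term>\<open>1 \<le> i\<close>, \<^term>\<open>i < j\<close>, \<^term>\<open>j \<le> k\<close>, is the relation between
  \<^term>\<open>x i\<close> and \<^term>\<open>x j\<close>; other values of \<^term>\<open>S\<close> are irrelevant.\<close>

type_synonym relations = "nat \<Rightarrow> nat \<Rightarrow> (nat \<times> nat) set"

definition clique_edges :: "nat \<Rightarrow> (nat \<times> nat) set"
where
  "clique_edges k = {(i, j). 1 \<le> i \<and> i < j \<and> j \<le> k}"

definition clique_instance :: "nat \<Rightarrow> nat \<Rightarrow> nat \<Rightarrow> relations \<Rightarrow> bool"
where
  "clique_instance k n m S \<longleftrightarrow>
     (\<forall>(i, j) \<in> clique_edges k. S i j \<subseteq> {1..n} \<times> {1..n} \<and> card (S i j) = m)"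

definition clique_answers :: "nat \<Rightarrow> nat \<Rightarrow> relations \<Rightarrow> (nat \<Rightarrow> nat) set"
where
  "clique_answers k n S =
     {x \<in> {1..k} \<rightarrow>\<^sub>E {1..n}. \<forall>(i, j) \<in> clique_edges k. (x i, x j) \<in> S i j}"

text \<open>The input as a set of tuples, each labelled with the relation it belongs to.\<close>

type_synonym labelled_tuple = "(nat \<times> nat) \<times> (nat \<times> nat)"

definition input_tuples :: "nat \<Rightarrow> relations \<Rightarrow> labelled_tuple set"
where
  "input_tuples k S = {((i, j), u). (i, j) \<in> clique_edges k \<and> u \<in> S i j}"

text \<open>The size in bits of a relation with \<^term>\<open>m\<close> tuples over a domain of \<^term>\<open>n\<close> elements.\<close>

definition size_in_bits :: "nat \<Rightarrow> nat \<Rightarrow> real"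
where
  "size_in_bits n m = 2 * real m * log 2 (real n)"


section \<open>Data statistics\<close>

text \<open>A pattern fixes the values of some of the two attributes; \<^term>\<open>None\<close> leaves one free.\<close>

type_synonym pattern = "nat option \<times> nat option"

definition frequency :: "(nat \<times> nat) set \<Rightarrow> pattern \<Rightarrow> nat"
where
  "frequency R h =
     card {(u, v) \<in> R. (fst h = None \<or> fst h = Some u) \<and> (snd h = None \<or> snd h = Some v)}"

text \<open>A heavy hitter of a relation with \<^term>\<open>m\<close> tuples is a value (or tuple of values) of frequency
  more than \<open>m / p\<close>, so each attribute has fewer than \<^term>\<open>p\<close> of them.\<close>

record clique_statistics =
  domain_size :: nat
  relation_size :: nat
  heavy_hitters :: "((nat \<times> nat) \<times> pattern \<times> nat) set"

definition statistics_of :: "nat \<Rightarrow> nat \<Rightarrow> nat \<Rightarrow> nat \<Rightarrow> relations \<Rightarrow> clique_statistics"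
where
  "statistics_of k p n m S =
     \<lparr>domain_size = n, relation_size = m,
      heavy_hitters = {((i, j), h, f). (i, j) \<in> clique_edges k \<and> f = frequency (S i j) h
                                       \<and> real f > real m / real p}\<rparr>"

end

theory Submission
  imports Defs
begin

text \<open>
  Two rounds suffice; the remaining rounds are idle.  Call a value of an attribute dense if its
  frequency in some relation exceeds about \<open>m / p\<^sup>1\<^sup>/\<^sup>k\<close>, and light otherwise; there are \<open>O(p\<^sup>1\<^sup>/\<^sup>k)\<close> dense
  values per attribute.  Colour a dense value by itself and a light one by a random bucket among
  \<open>\<Theta>(p\<^sup>1\<^sup>/\<^sup>k)\<close>; the colour vectors then number at most \<open>p\<close>, and each is given to one server.  A server
  needs the pairs of light values with matching colours.  As the hash functions are independent, there
  are \<open>O(m / p\<^sup>2\<^sup>/\<^sup>k)\<close> of them up to logarithmic factors, but the unary relations \<open>S\<^sub>u\<^sub>i(h, x\<^sub>i)\<close> with a dense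
  \<open>h\<close> in the colour vector may be too large to be sent.  They are therefore never sent: the light pairs
  are semijoined with them beforehand.  To make this possible, the first round gathers the whole
  neighbourhood of every value of frequency at most \<open>m / p\<close> at a random server, and broadcasts the
  tuples that join two of the values listed in the statistics, whose number is polynomial in \<open>p\<close>.
  Answers with at most one light value are already visible after that round.
\<close>

section \<open>Random hashing\<close>

lemma card_fiber_sum:
  assumes "finite R" "finite V" "\<pi> ` R \<subseteq> V"
  shows "(\<Sum>v\<in>V. card {r \<in> R. \<pi> r = v}) = card R"
  using sum.group[OF assms, of "\<lambda>_. 1 :: nat"] by simp

lemma card_UN_bound:
  fixes c :: real
  assumes "finite L" "\<And>l. l \<in> L \<Longrightarrow> real (card (A l)) \<le> c"
  shows "real (card (\<Union>l\<in>L. A l)) \<le> real (card L) * c"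
proof -
  have "real (card (\<Union>l\<in>L. A l)) \<le> (\<Sum>l\<in>L. real (card (A l)))"
    using card_UN_le[OF assms(1), of A] by (simp flip: of_nat_sum)
  also have "\<dots> \<le> real (card L) * c"
    using sum_bounded_above[of L "\<lambda>l. real (card (A l))" c] assms(2) by simp
  finally show ?thesis .
qed

text \<open>Markov's inequality for counting: fibres are disjoint, so those exceeding
  \<open>\<theta>\<close> together use up at most \<open>card R\<close> elements. As
  \<open>0 \<le> \<theta>\<close>, such a fibre is nonempty, which gives finiteness.\<close>

lemma card_large_fibers:
  fixes \<theta> :: real
  assumes "finite R" "0 \<le> \<theta>"
  shows "finite {v. \<theta> < real (card {r \<in> R. \<pi> r = v})}"
    and "real (card {v. \<theta> < real (card {r \<in> R. \<pi> r = v})}) * \<theta> \<le> real (card R)"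
proof -
  let ?V = "{v. \<theta> < real (card {r \<in> R. \<pi> r = v})}"
  have sub: "?V \<subseteq> \<pi> ` R"
  proof
    fix v assume "v \<in> ?V"
    then have "card {r \<in> R. \<pi> r = v} \<noteq> 0" using assms(2) by auto
    then have "{r \<in> R. \<pi> r = v} \<noteq> {}" by force
    then show "v \<in> \<pi> ` R" by auto
  qed
  then show fin: "finite ?V"
    by (rule finite_subset) (simp add: assms(1))
  have "real (card ?V) * \<theta> = (\<Sum>v\<in>?V. \<theta>)" by simp
  also have "\<dots> \<le> (\<Sum>v\<in>?V. real (card {r \<in> R. \<pi> r = v}))"
    by (rule sum_mono) auto
  also have "\<dots> \<le> (\<Sum>v\<in>\<pi> ` R. real (card {r \<in> R. \<pi> r = v}))"
    by (rule sum_mono2) (use sub assms(1) in simp_all)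
  also have "\<dots> = real (card R)"
    using card_fiber_sum[OF assms(1) finite_imageI[OF assms(1)] order_refl, of \<pi>] by (metis of_nat_sum)
  finally show "real (card ?V) * \<theta> \<le> real (card R)" .
qed

section \<open>Exponential tail bounds for one hash bucket\<close>

abbreviation uniform_hash :: "'v set \<Rightarrow> nat \<Rightarrow> ('v \<Rightarrow> nat) pmf" where
  "uniform_hash V b \<equiv> Pi_pmf V 0 (\<lambda>_. pmf_of_set {..<b})"

text \<open>With finite support every real function is integrable, so no integrability conditions
  remain in the tail bounds.\<close>

lemma finite_set_uniform_hash:
  assumes "finite V" "b > 0"
  shows "finite (set_pmf (uniform_hash V b))"
  using assms by (subst set_Pi_pmf) (auto intro!: finite_PiE_dflt simp: set_pmf_of_set lessThan_empty_iff)

text \<open>The content of bucket \<open>s\<close> is a sum over \<open>v\<close> of independent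
  terms, each equal to the fibre size \<open>w v\<close> with probability at most
  \<open>1 / b\<close> and 0 otherwise. After division by the maximal fibre size \<open>a\<close>
  each term lies in [0,1], so its exponential has mean at most
  \<open>exp (2 * w v / (a * b))\<close>, and the product of these means is at most
  \<open>exp 2\<close>.\<close>

lemma bucket_exp_moment:
  fixes a :: real and R :: "'r set" and \<pi> :: "'r \<Rightarrow> 'v"
  assumes "finite R" "finite V" "\<pi> ` R \<subseteq> V" "b > 0" "a > 0"
    and deg: "\<And>v. v \<in> V \<Longrightarrow> real (card {r \<in> R. \<pi> r = v}) \<le> a"
    and total: "real (card R) \<le> a * b"
  shows "measure_pmf.expectation (uniform_hash V b)
           (\<lambda>f. exp (real (card {r \<in> R. f (\<pi> r) = s}) / a)) \<le> exp 2"
proof -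
  define w where "w v = real (card {r \<in> R. \<pi> r = v})" for v
  have w: "0 \<le> w v" "v \<in> V \<Longrightarrow> w v \<le> a" for v
    using deg by (auto simp: w_def)
  have sum_w: "(\<Sum>v\<in>V. w v) = real (card R)"
    unfolding w_def using card_fiber_sum[OF assms(1-3)] by (metis of_nat_sum)
  have decomp: "exp (real (card {r \<in> R. f (\<pi> r) = s}) / a)
      = (\<Prod>v\<in>V. exp (w v * indicator {s} (f v) / a))" for f
  proof -
    have "real (card {r \<in> R. f (\<pi> r) = s}) = (\<Sum>v\<in>V. w v * indicator {s} (f v))"
    proof -
      have "card {r \<in> R. f (\<pi> r) = s} = (\<Sum>v\<in>V. card {r' \<in> {r \<in> R. f (\<pi> r) = s}. \<pi> r' = v})"
        using assms by (intro card_fiber_sum[symmetric]) auto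
      also have "real \<dots> = (\<Sum>v\<in>V. w v * indicator {s} (f v))"
        unfolding of_nat_sum
      proof (rule sum.cong)
        fix v assume "v \<in> V"
        have "{r' \<in> {r \<in> R. f (\<pi> r) = s}. \<pi> r' = v} = (if f v = s then {r \<in> R. \<pi> r = v} else {})"
          by auto
        then show "real (card {r' \<in> {r \<in> R. f (\<pi> r) = s}. \<pi> r' = v}) = w v * indicator {s} (f v)"
          by (auto simp: w_def indicator_def)
      qed simp
      finally show ?thesis .
    qed
    then show ?thesis
      using \<open>finite V\<close> by (simp only: sum_divide_distrib exp_sum)
  qed
  have one: "measure_pmf.expectation (pmf_of_set {..<b}) (\<lambda>h. exp (w v * indicator {s} h / a))
      \<le> exp (2 * w v / (a * b))" if "v \<in> V" for v
  proof -
    let ?y = "w v / a"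
    have y: "0 \<le> ?y" "?y \<le> 1" using w that \<open>a > 0\<close> by auto
    \<comment> \<open>On [0,1] the exponential lies below the line \<open>1 + 2 * y\<close>, which
      turns the mean into a linear estimate.\<close>
    have "exp ?y \<le> 1 + ?y + ?y\<^sup>2" using exp_bound y by blast
    also have "\<dots> \<le> 1 + 2 * ?y"
      using y mult_left_le[of ?y ?y] by (simp add: power2_eq_square)
    finally have ey: "exp ?y \<le> 1 + 2 * ?y" .
    have "measure_pmf.expectation (pmf_of_set {..<b}) (\<lambda>h. exp (w v * indicator {s} h / a))
        = (\<Sum>h<b. exp (w v * indicator {s} h / a)) / b"
      using \<open>b > 0\<close> by (subst integral_pmf_of_set) (auto simp: lessThan_empty_iff)
    also have "\<dots> \<le> (\<Sum>h<b. 1 + (if h = s then 2 * ?y else 0)) / b"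
      using ey by (intro divide_right_mono sum_mono) (auto simp: indicator_def)
    \<comment> \<open>Only an inequality, because \<open>s\<close> may lie outside the range of the
      hash function.\<close>
    also have "\<dots> \<le> (b + 2 * ?y) / b"
      using y by (intro divide_right_mono) (auto simp: sum.distrib)
    also have "\<dots> = 1 + 2 * w v / (a * b)"
      using \<open>b > 0\<close> \<open>a > 0\<close> by (simp add: field_simps)
    also have "\<dots> \<le> exp (2 * w v / (a * b))" by (rule exp_ge_add_one_self)
    finally show ?thesis .
  qed
  have "measure_pmf.expectation (uniform_hash V b) (\<lambda>f. exp (real (card {r \<in> R. f (\<pi> r) = s}) / a))
     = measure_pmf.expectation (uniform_hash V b) (\<lambda>f. \<Prod>v\<in>V. exp (w v * indicator {s} (f v) / a))"
    by (simp add: decomp)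
  also have "\<dots> = (\<Prod>v\<in>V. measure_pmf.expectation (pmf_of_set {..<b}) (\<lambda>h. exp (w v * indicator {s} h / a)))"
    using assms
    by (intro expectation_prod_Pi_pmf integrable_measure_pmf_finite)
       (auto simp: set_pmf_of_set lessThan_empty_iff)
  also have "\<dots> \<le> (\<Prod>v\<in>V. exp (2 * w v / (a * b)))"
    using one by (intro prod_mono) (auto intro!: integral_nonneg)
  also have "\<dots> = exp (2 * real (card R) / (a * b))"
    using \<open>finite V\<close> by (simp add: exp_sum[symmetric] sum_w[symmetric] sum_distrib_left sum_divide_distrib)
  also have "\<dots> \<le> exp 2"
    using total \<open>b > 0\<close> \<open>a > 0\<close> by (simp add: field_simps)
  finally show ?thesis .
qed

text \<open>Chernoff's method: Markov's inequality for the exponential moment. The bound is free of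
  \<open>card V\<close>, so the domain size never enters a failure probability.\<close>

lemma bucket_tail:
  fixes a :: real and R :: "'r set" and \<pi> :: "'r \<Rightarrow> 'v"
  assumes "finite R" "finite V" "\<pi> ` R \<subseteq> V" "b > 0" "a > 0"
    and "\<And>v. v \<in> V \<Longrightarrow> real (card {r \<in> R. \<pi> r = v}) \<le> a"
    and "real (card R) \<le> a * b"
  shows "measure_pmf.prob (uniform_hash V b)
           {f. T * a < real (card {r \<in> R. f (\<pi> r) = s})} \<le> exp (2 - T)"
proof -
  let ?M = "uniform_hash V b" and ?X = "\<lambda>f. real (card {r \<in> R. f (\<pi> r) = s}) / a"
  have int: "integrable (measure_pmf ?M) h" for h :: "_ \<Rightarrow> real"
    using finite_set_uniform_hash assms by (intro integrable_measure_pmf_finite) auto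
  have "{f. T * a < real (card {r \<in> R. f (\<pi> r) = s})} \<subseteq> {f \<in> space ?M. exp T \<le> exp (?X f)}"
    using \<open>a > 0\<close> by (auto simp: field_simps)
  then have "measure_pmf.prob ?M {f. T * a < real (card {r \<in> R. f (\<pi> r) = s})}
      \<le> measure_pmf.prob ?M {f \<in> space ?M. exp T \<le> exp (?X f)}"
    by (intro measure_pmf.finite_measure_mono) auto
  also have "\<dots> \<le> measure_pmf.expectation ?M (\<lambda>f. exp (?X f)) / exp T"
    using int by (intro integral_Markov_inequality_measure[where A = "{}"]) auto
  also have "\<dots> \<le> exp 2 / exp T"
    using bucket_exp_moment[OF assms(1-5), of s] assms(6-7) by (intro divide_right_mono) auto
  finally show ?thesis by (simp add: exp_diff)
qed

section \<open>Union bounds, conditioning and hashing of both columns\<close>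

lemma prob_bex_le:
  fixes c :: real
  assumes "finite I" "\<And>i. i \<in> I \<Longrightarrow> measure_pmf.prob M {x. P i x} \<le> c"
  shows "measure_pmf.prob M {x. \<exists>i\<in>I. P i x} \<le> card I * c"
proof -
  have "{x. \<exists>i\<in>I. P i x} = (\<Union>i\<in>I. {x. P i x})" by auto
  then have "measure_pmf.prob M {x. \<exists>i\<in>I. P i x} \<le> (\<Sum>i\<in>I. measure_pmf.prob M {x. P i x})"
    using measure_pmf.finite_measure_subadditive_finite[OF assms(1), of "\<lambda>i. {x. P i x}" M] by simp
  also have "\<dots> \<le> card I * c"
    using sum_bounded_above[of I _ c] assms(2) by fastforce
  finally show ?thesis .
qed

lemma prob_ex_less_le:
  fixes c :: real
  assumes "\<And>i. i < b \<Longrightarrow> measure_pmf.prob M {x. P i x} \<le> c"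
  shows "measure_pmf.prob M {x. \<exists>i<b. P i x} \<le> real b * c"
  using prob_bex_le[of "{..<b}" M P c] assms by (simp add: Bex_def)

text \<open>Fubini: the section of \<open>Q\<close> over \<open>f\<close> has probability at most 1
  if \<open>f\<close> is in \<open>B\<close>, and at most \<open>d\<close> otherwise.\<close>

lemma prob_pair_pmf_le:
  fixes c d :: real
  assumes "measure_pmf.prob M B \<le> c" "0 \<le> d"
    and "\<And>f. f \<notin> B \<Longrightarrow> measure_pmf.prob N {g. (f, g) \<in> Q} \<le> d"
  shows "measure_pmf.prob (pair_pmf M N) Q \<le> c + d"
proof -
  have le: "emeasure (measure_pmf N) {g. (f, g) \<in> Q} \<le> indicator B f + ennreal d" for f
  proof (cases "f \<in> B")
    case True
    have "emeasure (measure_pmf N) {g. (f, g) \<in> Q} \<le> 1"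
      by (simp add: measure_pmf.emeasure_le_1)
    then show ?thesis using True by (simp add: add_increasing2)
  next
    case False
    then show ?thesis
      using assms(3) by (simp add: measure_pmf.emeasure_eq_measure ennreal_leI)
  qed
  have "emeasure (measure_pmf (pair_pmf M N)) Q = (\<integral>\<^sup>+f. emeasure (measure_pmf N) {g. (f, g) \<in> Q} \<partial>measure_pmf M)"
    by (simp add: nn_integral_pair_pmf' flip: nn_integral_indicator) (simp add: indicator_def)
  also have "\<dots> \<le> (\<integral>\<^sup>+f. indicator B f + ennreal d \<partial>measure_pmf M)"
    using le by (rule nn_integral_mono)
  also have "\<dots> = emeasure (measure_pmf M) B + ennreal d"
    by (simp add: nn_integral_add)
  also have "\<dots> \<le> ennreal (c + d)"
    using assms(1,2) measure_nonneg[of M B]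
    by (auto simp: measure_pmf.emeasure_eq_measure simp flip: ennreal_plus intro!: ennreal_leI)
  finally show ?thesis
    using assms(1,2) measure_nonneg[of M B]
    by (auto simp: measure_pmf.emeasure_eq_measure simp del: ennreal_plus)
qed

text \<open>Condition on the hash function of the first column: after fixing a bucket there, each value \<open>y\<close> of
  the second column has small residual degree.  Values of degree at most \<open>m / b\<^sup>2\<close> need no argument, and
  at most \<open>b\<^sup>2\<close> values have larger degree, so the union bound does not involve the number of values.\<close>

lemma grid_tail:
  fixes R :: "('x \<times> 'y) set" and K T m :: real
  assumes fin: "finite X" "finite Y" and R: "R \<subseteq> X \<times> Y" and "b > 0" "1 \<le> K" "1 \<le> T"
    and m: "real (card R) \<le> m" "real b ^ 2 \<le> m"
    and deg_fst: "\<And>x. real (card {r \<in> R. fst r = x}) \<le> K * m / b"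
    and deg_snd: "\<And>y. real (card {r \<in> R. snd r = y}) \<le> K * m / b"
  shows "measure_pmf.prob (pair_pmf (uniform_hash X b) (uniform_hash Y b))
      {(f, g). \<exists>\<alpha><b. \<exists>\<beta><b. K * T ^ 2 * m / real b ^ 2 < real (card {r \<in> R. f (fst r) = \<alpha> \<and> g (snd r) = \<beta>})}
    \<le> 3 * real b ^ 3 * exp (2 - T)"
proof -
  let ?e = "exp (2 - T)"
  have finR: "finite R" using fin R finite_subset by blast
  have b: "1 \<le> real b" using \<open>b > 0\<close> by simp
  have b2: "1 \<le> real b ^ 2" using b by (simp add: one_le_power)
  have mpos: "0 < m" using m(2) b2 by linarith
  have sub: "fst ` R \<subseteq> X" "snd ` R \<subseteq> Y" using R by auto
  define Yh where "Yh = {y. m / real b ^ 2 < real (card {r \<in> R. snd r = y})}"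
  have Yh: "finite Yh" "real (card Yh) \<le> real b ^ 2"
  proof -
    show "finite Yh"
      unfolding Yh_def using finR mpos by (intro card_large_fibers(1)) auto
    have "real (card Yh) * (m / real b ^ 2) \<le> real (card R)"
      unfolding Yh_def using finR mpos by (intro card_large_fibers(2)) auto
    also have "\<dots> \<le> real b ^ 2 * (m / real b ^ 2)"
      using m(1) b by simp
    finally show "real (card Yh) \<le> real b ^ 2"
      using mpos b by (subst (asm) mult_le_cancel_right_pos) auto
  qed
  \<comment> \<open>The two ways in which \<open>f\<close> can fail: a bucket of the first column is
    too full as a whole, or it takes too large a share of the tuples over one high-degree
    \<open>y\<close>.\<close>
  define crowded where "crowded f \<longleftrightarrow> (\<exists>\<alpha><b. T * (K * m / b) < real (card {r \<in> R. f (fst r) = \<alpha>}))" for f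
  define skewed where "skewed f \<longleftrightarrow> (\<exists>\<alpha><b. \<exists>y\<in>Yh.
      T * (K * m / real b ^ 2) < real (card {r \<in> {r \<in> R. snd r = y}. f (fst r) = \<alpha>}))" for f
  have mK: "m \<le> K * m" using mpos \<open>1 \<le> K\<close> by simp
  have total: "real (card R) \<le> K * m / b * b"
    using m(1) mK \<open>b > 0\<close> by simp
  have crowded: "measure_pmf.prob (uniform_hash X b) {f. crowded f} \<le> b * ?e"
  proof -
    have "measure_pmf.prob (uniform_hash X b) {f. T * (K * m / b) < real (card {r \<in> R. f (fst r) = \<alpha>})} \<le> ?e" for \<alpha>
      using fin finR sub deg_fst total mpos b \<open>1 \<le> K\<close> by (intro bucket_tail) auto
    then show ?thesis
      unfolding crowded_def by (rule prob_ex_less_le)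
  qed
  have skewed: "measure_pmf.prob (uniform_hash X b) {f. skewed f} \<le> b * (real b ^ 2 * ?e)"
  proof -
    have one: "measure_pmf.prob (uniform_hash X b)
        {f. T * (K * m / real b ^ 2) < real (card {r \<in> {r \<in> R. snd r = y}. f (fst r) = \<alpha>})} \<le> ?e" for \<alpha> y
    proof (intro bucket_tail)
      show "real (card {r \<in> R. snd r = y}) \<le> K * m / real b ^ 2 * b"
        using deg_snd[of y] b by (simp add: power2_eq_square)
      fix v
      \<comment> \<open>With \<open>y\<close> fixed, a tuple is determined by its first component,
        so the fibres have at most one element; \<open>real b ^ 2 \<le> m\<close> makes the unit
        \<open>K * m / real b ^ 2\<close> at least 1, as the tail bound requires.\<close>
      have "card {r \<in> {r \<in> R. snd r = y}. fst r = v} \<le> card {(v, y)}"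
        by (rule card_mono) auto
      moreover have "real b ^ 2 \<le> K * m"
        using m(2) mK by linarith
      then have "1 \<le> K * m / real b ^ 2" using \<open>b > 0\<close> by (subst le_divide_eq_1_pos) auto
      ultimately show "real (card {r \<in> {r \<in> R. snd r = y}. fst r = v}) \<le> K * m / real b ^ 2"
        by simp
    qed (use fin finR sub mpos b \<open>1 \<le> K\<close> in auto)
    have "measure_pmf.prob (uniform_hash X b) {f. \<exists>y\<in>Yh.
        T * (K * m / real b ^ 2) < real (card {r \<in> {r \<in> R. snd r = y}. f (fst r) = \<alpha>})} \<le> card Yh * ?e" for \<alpha>
      by (rule prob_bex_le) (use Yh one in auto)
    also have "card Yh * ?e \<le> real b ^ 2 * ?e"
      using Yh by (intro mult_right_mono) auto
    finally show ?thesis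
      unfolding skewed_def by (rule prob_ex_less_le)
  qed
  have "measure_pmf.prob (uniform_hash X b) {f. crowded f \<or> skewed f} \<le> b * ?e + b * (real b ^ 2 * ?e)"
  proof -
    have "{f. crowded f \<or> skewed f} = {f. crowded f} \<union> {f. skewed f}" by auto
    then show ?thesis
      using crowded skewed measure_Un_le[of "{f. crowded f}" "uniform_hash X b" "{f. skewed f}"]
      by simp
  qed
  moreover have "measure_pmf.prob (uniform_hash Y b)
      {g. (f, g) \<in> {(f, g). \<exists>\<alpha><b. \<exists>\<beta><b. K * T ^ 2 * m / real b ^ 2 < real (card {r \<in> R. f (fst r) = \<alpha> \<and> g (snd r) = \<beta>})}}
      \<le> b * (b * ?e)" if "f \<notin> {f. crowded f \<or> skewed f}" for f
  proof -
    have good: "\<not> crowded f" "\<not> skewed f" using that by auto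
    have light: "real (card {r \<in> {r \<in> R. f (fst r) = \<alpha>}. snd r = y}) \<le> T * (K * m / real b ^ 2)" if "\<alpha> < b" for \<alpha> y
    proof (cases "y \<in> Yh")
      case True
      have "{r \<in> {r \<in> R. f (fst r) = \<alpha>}. snd r = y} = {r \<in> {r \<in> R. snd r = y}. f (fst r) = \<alpha>}" by auto
      then show ?thesis
        using True \<open>\<alpha> < b\<close> good(2) unfolding skewed_def by (metis (no_types) not_less)
    next
      case False
      have "card {r \<in> {r \<in> R. f (fst r) = \<alpha>}. snd r = y} \<le> card {r \<in> R. snd r = y}"
        using finR by (intro card_mono) auto
      then have "real (card {r \<in> {r \<in> R. f (fst r) = \<alpha>}. snd r = y}) \<le> m / real b ^ 2"
        using False unfolding Yh_def by auto
      also have "\<dots> \<le> T * K * (m / real b ^ 2)"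
        using \<open>1 \<le> T\<close> \<open>1 \<le> K\<close> mpos mult_mono[of 1 T 1 K] mult_right_mono[of 1 "T * K" "m / real b ^ 2"] by simp
      finally show ?thesis by simp
    qed
    \<comment> \<open>The same tail bound inside one bucket of the first column. Its unit already
      contains a factor \<open>T\<close> from the choice of \<open>f\<close>, hence
      \<open>T ^ 2\<close> in the end.\<close>
    have one: "measure_pmf.prob (uniform_hash Y b)
        {g. T * (T * (K * m / real b ^ 2)) < real (card {r \<in> {r \<in> R. f (fst r) = \<alpha>}. g (snd r) = \<beta>})} \<le> ?e"
      if "\<alpha> < b" for \<alpha> \<beta>
    proof (rule bucket_tail)
      show "real (card {r \<in> R. f (fst r) = \<alpha>}) \<le> T * (K * m / real b ^ 2) * b"
        using \<open>\<alpha> < b\<close> good(1) b unfolding crowded_def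
        by (simp add: power2_eq_square) (meson not_less)
    qed (use fin finR sub mpos b \<open>1 \<le> K\<close> \<open>1 \<le> T\<close> light that in auto)
    have "measure_pmf.prob (uniform_hash Y b) {g. \<exists>\<alpha><b. \<exists>\<beta><b.
        T * (T * (K * m / real b ^ 2)) < real (card {r \<in> {r \<in> R. f (fst r) = \<alpha>}. g (snd r) = \<beta>})}
        \<le> b * (b * ?e)"
      by (intro prob_ex_less_le one)
    moreover have "{g. (f, g) \<in> {(f, g). \<exists>\<alpha><b. \<exists>\<beta><b. K * T ^ 2 * m / real b ^ 2 < real (card {r \<in> R. f (fst r) = \<alpha> \<and> g (snd r) = \<beta>})}}
      = {g. \<exists>\<alpha><b. \<exists>\<beta><b.
        T * (T * (K * m / real b ^ 2)) < real (card {r \<in> {r \<in> R. f (fst r) = \<alpha>}. g (snd r) = \<beta>})}"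
      by (auto simp: power2_eq_square mult_ac)
    ultimately show ?thesis by simp
  qed
  ultimately have "measure_pmf.prob (pair_pmf (uniform_hash X b) (uniform_hash Y b))
      {(f, g). \<exists>\<alpha><b. \<exists>\<beta><b. K * T ^ 2 * m / real b ^ 2 < real (card {r \<in> R. f (fst r) = \<alpha> \<and> g (snd r) = \<beta>})}
      \<le> (b * ?e + b * (real b ^ 2 * ?e)) + b * (b * ?e)"
    by (intro prob_pair_pmf_le) auto
  \<comment> \<open>The three summands count the crowded buckets, the pairs of a bucket and a
    high-degree value, and the grid squares.\<close>
  also have "\<dots> = (real b + real (b ^ 3) + real (b ^ 2)) * ?e"
    by (simp add: algebra_simps power2_eq_square power3_eq_cube)
  also have "\<dots> \<le> 3 * real b ^ 3 * ?e"
  proof (rule mult_right_mono)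
    have "real b \<le> real b ^ 3" using b by (intro self_le_power) auto
    moreover have "real b ^ 2 \<le> real b ^ 3" using b by (intro power_increasing) auto
    ultimately show "real b + real (b ^ 3) + real (b ^ 2) \<le> 3 * real b ^ 3"
      by (simp only: of_nat_power)
  qed simp
  finally show ?thesis by (simp only: of_nat_power)
qed

text \<open>Splitting off coordinate \<open>i\<close> leaves a product over \<open>A - {i}\<close>,
  whose \<open>j\<close> marginal is independent of it.\<close>

lemma map_pair_Pi_pmf:
  assumes "finite A" "i \<in> A" "j \<in> A" "i \<noteq> j"
  shows "map_pmf (\<lambda>f. (f i, f j)) (Pi_pmf A d P) = pair_pmf (P i) (P j)"
proof -
  have "Pi_pmf A d P = map_pmf (\<lambda>(y, f). f(i := y)) (pair_pmf (P i) (Pi_pmf (A - {i}) d P))"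
    using Pi_pmf_insert[of "A - {i}" i d P] assms by (simp add: insert_absorb)
  then have "map_pmf (\<lambda>f. (f i, f j)) (Pi_pmf A d P)
      = map_pmf (\<lambda>(y, f). (y, f j)) (pair_pmf (P i) (Pi_pmf (A - {i}) d P))"
    using assms by (simp add: pmf.map_comp o_def case_prod_unfold)
  also have "\<dots> = pair_pmf (P i) (map_pmf (\<lambda>f. f j) (Pi_pmf (A - {i}) d P))"
    using map_pair[of id "\<lambda>f. f j" "P i" "Pi_pmf (A - {i}) d P"] by (simp add: id_def)
  also have "map_pmf (\<lambda>f. f j) (Pi_pmf (A - {i}) d P) = P j"
    using assms by (subst Pi_pmf_component) auto
  finally show ?thesis .
qed

text \<open>The slack in the tail bounds will be \<open>T = 5 * ln p\<close>, and
  \<open>1 \<le> T\<close> is required there.\<close>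

lemma five_ln_ge_1: "2 \<le> p \<Longrightarrow> 1 \<le> 5 * ln (real p)"
proof -
  assume "2 \<le> p"
  then have "ln 2 \<le> ln (real p)" by simp
  moreover have "1 / 2 \<le> ln (2 :: real)"
    using ln_le_minus_one[of "1 / 2"] by (simp add: ln_div)
  ultimately show ?thesis by linarith
qed

section \<open>Messages\<close>

text \<open>Concatenate codewords of fixed width \<open>w\<close> in an arbitrary order of the
  elements. Blocks of equal width can be cut apart without delimiters, so the length is exactly
  proportional to the cardinality.\<close>

lemma exists_set_encoding:
  assumes "finite T" "card T \<le> 2 ^ w" "w > 0"
  shows "\<exists>e :: 'c set \<Rightarrow> bool list. inj_on e (Pow T) \<and> (\<forall>X\<subseteq>T. length (e X) = w * card X)"
proof -
  have "finite {l :: bool list. length l = w}" "card {l :: bool list. length l = w} = 2 ^ w"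
    using card_lists_length_eq[of "UNIV :: bool set" w] finite_lists_length_eq[of "UNIV :: bool set" w]
    by (auto simp: card_UNIV_bool)
  then obtain g :: "'c \<Rightarrow> bool list" where g: "inj_on g T" "g ` T \<subseteq> {l. length l = w}"
    using assms card_le_inj[of T "{l :: bool list. length l = w}"] by auto
  define lst where "lst X = (SOME xs :: 'c list. set xs = X \<and> distinct xs)" for X
  have lst: "set (lst X) = X" "distinct (lst X)" if "X \<subseteq> T" for X
    using someI_ex[of "\<lambda>xs. set xs = X \<and> distinct xs"] finite_distinct_list[of X]
      finite_subset[OF that assms(1)] unfolding lst_def by blast+
  define e where "e X = concat (map g (lst X))" for X
  have len: "length (g c) = w" if "c \<in> T" for c
    using g that by blast
  have length_e: "length (e X) = w * card X" if X: "X \<subseteq> T" for X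
  proof -
    have "map (length \<circ> g) (lst X) = map (\<lambda>_. w) (lst X)"
      using lst[OF X] len X by auto
    then have "length (e X) = length (lst X) * w"
      by (simp add: e_def length_concat comp_def sum_list_triv del: map_eq_conv)
    then show ?thesis
      using distinct_card[OF lst(2)[OF X]] lst(1)[OF X] by simp
  qed
  have "inj_on e (Pow T)"
  proof (rule inj_onI)
    fix X Y assume "X \<in> Pow T" "Y \<in> Pow T" and eq: "e X = e Y"
    then have XY: "X \<subseteq> T" "Y \<subseteq> T" by auto
    \<comment> \<open>Positive width is what allows the number of codewords to be read off the
      length.\<close>
    have "card X = card Y"
      using length_e[OF XY(1)] length_e[OF XY(2)] eq \<open>w > 0\<close> by simp
    then have ll: "length (lst X) = length (lst Y)"
      using distinct_card lst XY by metis
    have "map g (lst X) = map g (lst Y)"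
    proof (rule concat_injective)
      show "concat (map g (lst X)) = concat (map g (lst Y))"
        using eq by (simp add: e_def)
      show "length (map g (lst X)) = length (map g (lst Y))"
        using ll by simp
      show "\<forall>(x, y)\<in>set (zip (map g (lst X)) (map g (lst Y))). length x = length y"
      proof clarify
        fix x y assume "(x, y) \<in> set (zip (map g (lst X)) (map g (lst Y)))"
        then have "x \<in> set (map g (lst X))" "y \<in> set (map g (lst Y))"
          by (meson set_zip_leftD set_zip_rightD)+
        then have "x \<in> g ` T" "y \<in> g ` T"
          using lst(1) XY by auto
        then show "length x = length y"
          using len by auto
      qed
    qed
    then have "g ` X = g ` Y"
      using lst(1) XY by (metis list.set_map)
    then show "X = Y"
      using inj_on_image_eq_iff[OF g(1)] XY by blast
  qed
  then show ?thesis using length_e by blast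
qed

text \<open>One alphabet serves both rounds. The flag names an endpoint of the tuple in the second
  round; the first round sets it to \<open>False\<close>.\<close>

definition items :: "nat \<Rightarrow> nat \<Rightarrow> (bool \<times> labelled_tuple) set" where
  "items k n = UNIV \<times> (({1..k} \<times> {1..k}) \<times> ({1..n} \<times> {1..n}))"

text \<open>One bit for the flag, \<open>k\<close> bits for each attribute index (as
  \<open>k \<le> 2 ^ k\<close>), and a rounded-up logarithm for each value.\<close>

definition item_width :: "nat \<Rightarrow> nat \<Rightarrow> nat" where
  "item_width k n = 1 + 2 * k + 2 * nat \<lceil>log 2 (real n)\<rceil>"

definition encode :: "nat \<Rightarrow> nat \<Rightarrow> (bool \<times> labelled_tuple) set \<Rightarrow> bool list" where
  "encode k n = (SOME e. inj_on e (Pow (items k n)) \<and>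
                         (\<forall>X\<subseteq>items k n. length (e X) = item_width k n * card X))"

definition decode :: "nat \<Rightarrow> nat \<Rightarrow> bool list \<Rightarrow> (bool \<times> labelled_tuple) set" where
  "decode k n = inv_into (Pow (items k n)) (encode k n)"

lemma finite_items: "finite (items k n)"
  by (simp add: items_def)

lemma card_items_le: "card (items k n) \<le> 2 ^ item_width k n"
proof (cases "n = 0")
  case True
  then show ?thesis by (simp add: items_def)
next
  case False
  have "real n = 2 powr (log 2 (real n))" using False by simp
  also have "\<dots> \<le> 2 powr real (nat \<lceil>log 2 (real n)\<rceil>)"
    by (intro powr_mono) (auto intro: real_nat_ceiling_ge)
  also have "\<dots> = 2 ^ nat \<lceil>log 2 (real n)\<rceil>" by (simp add: powr_realpow)
  finally have n: "n \<le> 2 ^ nat \<lceil>log 2 (real n)\<rceil>" by (simp flip: of_nat_le_iff)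
  have k: "k \<le> 2 ^ k" by (simp add: less_imp_le)
  have "card (items k n) = 2 * (k * k) * (n * n)"
    by (simp add: items_def card_cartesian_product)
  also have "\<dots> \<le> 2 * (2 ^ k * 2 ^ k) * (2 ^ nat \<lceil>log 2 (real n)\<rceil> * 2 ^ nat \<lceil>log 2 (real n)\<rceil>)"
    by (intro mult_mono n k order_refl) auto
  also have "\<dots> = 2 ^ item_width k n"
    by (simp add: item_width_def power_add mult_2[of k] mult_2[of "nat \<lceil>log 2 (real n)\<rceil>"])
  finally show ?thesis .
qed

lemma inj_on_encode: "inj_on (encode k n) (Pow (items k n))"
  and length_encode: "X \<subseteq> items k n \<Longrightarrow> length (encode k n X) = item_width k n * card X"
proof -
  have "\<exists>e :: _ \<Rightarrow> bool list. inj_on e (Pow (items k n)) \<and> (\<forall>X\<subseteq>items k n. length (e X) = item_width k n * card X)"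
    by (rule exists_set_encoding[OF finite_items card_items_le]) (simp add: item_width_def)
  from someI_ex[OF this] show "inj_on (encode k n) (Pow (items k n))"
    and "X \<subseteq> items k n \<Longrightarrow> length (encode k n X) = item_width k n * card X"
    unfolding encode_def by blast+
qed

lemma decode_encode: "X \<subseteq> items k n \<Longrightarrow> decode k n (encode k n X) = X"
  unfolding decode_def by (rule inv_into_f_f[OF inj_on_encode]) simp

section \<open>The algorithm\<close>

definition endpoint :: "bool \<Rightarrow> labelled_tuple \<Rightarrow> nat \<times> nat" where
  "endpoint \<sigma> \<tau> = (if \<sigma> then (snd (fst \<tau>), snd (snd \<tau>)) else (fst (fst \<tau>), fst (snd \<tau>)))"

text \<open>Inverse to taking the two endpoints, in either order. For two values of the same
  attribute the label is not an edge, so the result is not an input tuple.\<close>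

definition link :: "nat \<times> nat \<Rightarrow> nat \<times> nat \<Rightarrow> labelled_tuple" where
  "link a b = (if fst a < fst b then ((fst a, fst b), (snd a, snd b))
               else ((fst b, fst a), (snd b, snd a)))"

text \<open>Phrased through the published statistics only, so that every server can evaluate it. It
  agrees with actual frequencies for thresholds of at least \<open>m / p\<close>.\<close>

definition heavy :: "clique_statistics \<Rightarrow> real \<Rightarrow> nat \<times> nat \<Rightarrow> bool" where
  "heavy q \<theta> e \<longleftrightarrow> (\<exists>l f. \<theta> < real f \<and>
     ((l, (Some (snd e), None), f) \<in> heavy_hitters q \<and> fst l = fst e \<or>
      (l, (None, Some (snd e)), f) \<in> heavy_hitters q \<and> snd l = fst e))"

definition side :: "nat \<Rightarrow> nat \<Rightarrow> nat" where
  "side k p = nat \<lfloor>root k (real p)\<rfloor>"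

text \<open>Half of the colours of an attribute, rounded up so that there is at least one; the other
  half is reserved for dense values.\<close>

definition buckets :: "nat \<Rightarrow> nat \<Rightarrow> nat" where
  "buckets k p = side k p - side k p div 2"

definition listed :: "nat \<Rightarrow> clique_statistics \<Rightarrow> nat \<times> nat \<Rightarrow> bool" where
  "listed p q = heavy q (real (relation_size q) / real p)"

text \<open>The factor \<open>4 k\<^sup>2\<close> ensures that an attribute has at most \<open>side k p div 2\<close> dense values,
  hence, with its buckets, at most \<open>side k p\<close> colours.\<close>

definition dense :: "nat \<Rightarrow> nat \<Rightarrow> clique_statistics \<Rightarrow> nat \<times> nat \<Rightarrow> bool" where
  "dense k p q = heavy q (4 * real k ^ 2 * real (relation_size q) / real (side k p))"

type_synonym hash = "nat \<Rightarrow> nat \<Rightarrow> nat"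

text \<open>The first family chooses servers for unlisted values, the second chooses buckets for
  values that are not dense. Independence across attributes is what the two-column bound rests
  on.\<close>

definition hashes :: "nat \<Rightarrow> nat \<Rightarrow> clique_statistics \<Rightarrow> (hash \<times> hash) pmf" where
  "hashes k p q =
     pair_pmf (Pi_pmf {1..k} (\<lambda>_. 0) (\<lambda>_. uniform_hash {1..domain_size q} p))
              (Pi_pmf {1..k} (\<lambda>_. 0) (\<lambda>_. uniform_hash {1..domain_size q} (buckets k p)))"

definition cells :: "nat \<Rightarrow> nat \<Rightarrow> clique_statistics \<Rightarrow> (nat \<Rightarrow> nat + nat) set" where
  "cells k p q = (\<Pi>\<^sub>E i\<in>{1..k}. Inl ` {..<buckets k p} \<union> Inr ` {v. dense k p q (i, v)})"

text \<open>A server whose index exceeds the number of cells is also assigned some cell; it repeats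
  work already done elsewhere, and soundness and load are proved for all servers alike.\<close>

definition cell :: "nat \<Rightarrow> nat \<Rightarrow> clique_statistics \<Rightarrow> nat \<Rightarrow> nat \<Rightarrow> nat + nat" where
  "cell k p q s = from_nat_into (cells k p q) s"

text \<open>Only unlisted endpoints are hashed: a listed value may occur too often for one server to
  take its whole neighbourhood.\<close>

definition first_round ::
  "nat \<Rightarrow> clique_statistics \<Rightarrow> hash \<Rightarrow> labelled_tuple set \<Rightarrow> nat \<Rightarrow> labelled_tuple set" where
  "first_round p q H X t =
     {\<tau> \<in> X. (\<forall>\<sigma>. listed p q (endpoint \<sigma> \<tau>)) \<or>
             (\<exists>\<sigma>. \<not> listed p q (endpoint \<sigma> \<tau>) \<and> case_prod H (endpoint \<sigma> \<tau>) = t)}"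

text \<open>In an item \<open>(\<sigma>, \<tau>)\<close>, the endpoint \<open>\<sigma>\<close> of \<open>\<tau>\<close> has been checked against the dense values of the
  receiving cell.  The sender is the one server that both holds \<open>\<tau>\<close> and knows all dense neighbours of that
  endpoint: the owner of \<open>\<tau>\<close> if the endpoint is listed, and its hash server otherwise.\<close>

definition second_round ::
  "nat \<Rightarrow> nat \<Rightarrow> clique_statistics \<Rightarrow> hash \<times> hash \<Rightarrow> nat \<Rightarrow> labelled_tuple set \<Rightarrow> labelled_tuple set \<Rightarrow>
   nat \<Rightarrow> (bool \<times> labelled_tuple) set" where
  "second_round k p q h s X Y t =
     {(\<sigma>, \<tau>). (if listed p q (endpoint \<sigma> \<tau>) then \<tau> \<in> X
               else \<tau> \<in> Y \<and> case_prod (fst h) (endpoint \<sigma> \<tau>) = s) \<and>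
             (\<forall>\<rho>. \<not> dense k p q (endpoint \<rho> \<tau>) \<and>
                  cell k p q t (fst (endpoint \<rho> \<tau>)) = Inl (case_prod (snd h) (endpoint \<rho> \<tau>))) \<and>
             (\<forall>u\<in>{1..k}. \<forall>v. cell k p q t u = Inr v \<longrightarrow> link (u, v) (endpoint \<sigma> \<tau>) \<in> Y)}"

definition received ::
  "nat \<Rightarrow> (clique_statistics, labelled_tuple) view \<Rightarrow> nat \<Rightarrow> (bool \<times> labelled_tuple) set" where
  "received k v r = (\<Union>t<num_servers v. decode k (domain_size (statistics v)) ((inbox v ! r) t))"

text \<open>The last set holds tuples that were never transmitted in the second round: receiving
  \<open>(\<sigma>, \<tau>)\<close> certifies that endpoint \<open>\<sigma>\<close> is joined to all
  dense values of the receiver's own cell.\<close>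

definition known ::
  "nat \<Rightarrow> (clique_statistics, labelled_tuple) view \<Rightarrow> labelled_tuple set" where
  "known k v = snd ` received k v 0 \<union> snd ` received k v 1 \<union>
     {link (u, h) (endpoint \<sigma> \<tau>) | u h \<sigma> \<tau>. (\<sigma>, \<tau>) \<in> received k v 1 \<and> u \<in> {1..k} \<and>
        cell k (num_servers v) (statistics v) (self v) u = Inr h}"

text \<open>Seeds are natural numbers, hence the enumeration of the countable support of
  \<open>hashes\<close>. From the third round on all messages are empty.\<close>

definition two_round_join ::
  "nat \<Rightarrow> (clique_statistics, labelled_tuple, nat \<Rightarrow> nat) mpc_algorithm" where
  "two_round_join k =
     \<lparr>randomness = (\<lambda>p q. map_pmf (to_nat_on (set_pmf (hashes k p q))) (hashes k p q)),
      send = (\<lambda>v t.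
        let p = num_servers v; q = statistics v; n = domain_size q;
            h = from_nat_into (set_pmf (hashes k p q)) (seed v)
        in if length (inbox v) = 0 then encode k n (Pair False ` first_round p q (fst h) (fragment v) t)
           else if length (inbox v) = 1
           then encode k n (second_round k p q h (self v) (fragment v) (snd ` received k v 0) t)
           else []),
      result = (\<lambda>v. {x \<in> {1..k} \<rightarrow>\<^sub>E {1..domain_size (statistics v)}.
                      \<forall>(i, j) \<in> clique_edges k. ((i, j), (x i, x j)) \<in> known k v})\<rparr>"

section \<open>Views along an execution\<close>

lemma view_after_const [simp]:
  "self (view_after A p q D \<omega> r s) = s"
  "num_servers (view_after A p q D \<omega> r s) = p"
  "statistics (view_after A p q D \<omega> r s) = q"
  "seed (view_after A p q D \<omega> r s) = \<omega>"
  "fragment (view_after A p q D \<omega> r s) = D s"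
  "length (inbox (view_after A p q D \<omega> r s)) = r"
  by (induction r) auto

lemma inbox_view_after:
  "r' < r \<Longrightarrow> inbox (view_after A p q D \<omega> r s) ! r'
     = (\<lambda>t. if t < p then send A (view_after A p q D \<omega> r' t) s else [])"
  by (induction r) (auto simp: nth_append less_Suc_eq)

lemma send_two_round_join:
  "send (two_round_join k) v t =
     (let p = num_servers v; q = statistics v; n = domain_size q;
          h = from_nat_into (set_pmf (hashes k p q)) (seed v)
      in if inbox v = [] then encode k n (Pair False ` first_round p q (fst h) (fragment v) t)
         else if length (inbox v) = 1
         then encode k n (second_round k p q h (self v) (fragment v) (snd ` received k v 0) t)
         else [])"
  by (simp add: two_round_join_def)

lemma inbox_eq_Nil_iff [simp]: "inbox (view_after A p q D \<omega> r s) = [] \<longleftrightarrow> r = 0"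
  using view_after_const(6)[of A p q D \<omega> r s] by (metis length_0_conv)

section \<open>Heavy values and the integer root of the number of servers\<close>

lemma heavy_mono: "heavy q \<theta>' e \<Longrightarrow> \<theta> \<le> \<theta>' \<Longrightarrow> heavy q \<theta> e"
  unfolding heavy_def by (meson le_less_trans)

lemma finite_clique_edges: "finite (clique_edges k)"
  and card_clique_edges_le: "card (clique_edges k) \<le> k ^ 2"
proof -
  have sub: "clique_edges k \<subseteq> {1..k} \<times> {1..k}" by (auto simp: clique_edges_def)
  then show "finite (clique_edges k)" by (rule finite_subset) simp
  show "card (clique_edges k) \<le> k ^ 2"
    using card_mono[OF _ sub] by (simp add: power2_eq_square)
qed

lemma frequency_fst: "frequency R (Some v, None) = card {r \<in> R. fst r = v}"
  and frequency_snd: "frequency R (None, Some v) = card {r \<in> R. snd r = v}"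
  unfolding frequency_def by (auto intro!: arg_cong[of _ _ card])

text \<open>The statistics list exactly the frequencies above \<open>m / p\<close>, so a threshold
  at or above that value loses nothing.\<close>

lemma heavy_statistics_of:
  assumes "real m / real p \<le> \<theta>"
  shows "heavy (statistics_of k p n m S) \<theta> e \<longleftrightarrow>
    (\<exists>(i, j) \<in> clique_edges k. i = fst e \<and> \<theta> < real (card {r \<in> S i j. fst r = snd e}) \<or>
                             j = fst e \<and> \<theta> < real (card {r \<in> S i j. snd r = snd e}))"
  using assms unfolding heavy_def statistics_of_def
  by (auto simp: frequency_fst frequency_snd) (force simp: frequency_fst frequency_snd)+

text \<open>There are at most \<open>k ^ 2\<close> relations with two columns each, and a column of
  a relation has at most \<open>m / \<theta>\<close> values of frequency above
  \<open>\<theta>\<close>.\<close>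

lemma
  assumes inst: "clique_instance k n m S" and \<theta>: "real m / real p \<le> \<theta>"
  shows finite_heavy: "finite {v. heavy (statistics_of k p n m S) \<theta> (i, v)}"
    and card_heavy: "real (card {v. heavy (statistics_of k p n m S) \<theta> (i, v)}) * \<theta> \<le> 2 * real k ^ 2 * real m"
proof -
  have \<theta>0: "0 \<le> \<theta>" using \<theta> by (meson divide_nonneg_nonneg of_nat_0_le_iff order_trans)
  let ?F = "\<lambda>l. {v. \<theta> < real (card {r \<in> S (fst l) (snd l). fst r = v})}"
  let ?G = "\<lambda>l. {v. \<theta> < real (card {r \<in> S (fst l) (snd l). snd r = v})}"
  let ?V = "{v. heavy (statistics_of k p n m S) \<theta> (i, v)}"
  have "S (fst l) (snd l) \<subseteq> {1..n} \<times> {1..n}" "card (S (fst l) (snd l)) = m" if "l \<in> clique_edges k" for l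
    using inst that unfolding clique_instance_def by (auto simp: case_prod_unfold)
  then have S: "finite (S (fst l) (snd l))" "card (S (fst l) (snd l)) = m" if "l \<in> clique_edges k" for l
    using that finite_subset[of "S (fst l) (snd l)" "{1..n} \<times> {1..n}"] by auto
  have sub: "?V \<subseteq> (\<Union>l\<in>clique_edges k. ?F l \<union> ?G l)"
    unfolding heavy_statistics_of[OF \<theta>] by auto
  have fin: "finite (?F l \<union> ?G l)" if "l \<in> clique_edges k" for l
    using card_large_fibers(1)[OF S(1)[OF that] \<theta>0] by auto
  have finU: "finite (\<Union>l\<in>clique_edges k. ?F l \<union> ?G l)"
    using finite_clique_edges fin by blast
  then show "finite ?V" using sub by (rule rev_finite_subset)
  have "card ?V \<le> (\<Sum>l\<in>clique_edges k. card (?F l \<union> ?G l))"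
    using card_mono[OF finU sub] card_UN_le[OF finite_clique_edges] by (rule order_trans)
  then have "real (card ?V) \<le> (\<Sum>l\<in>clique_edges k. real (card (?F l \<union> ?G l)))"
    by (simp flip: of_nat_sum)
  then have "real (card ?V) * \<theta> \<le> (\<Sum>l\<in>clique_edges k. real (card (?F l \<union> ?G l)) * \<theta>)"
    using \<theta>0 by (simp add: mult_right_mono flip: sum_distrib_right)
  also have "\<dots> \<le> (\<Sum>l\<in>clique_edges k. 2 * real m)"
  proof (rule sum_mono)
    fix l assume l: "l \<in> clique_edges k"
    have "real (card (?F l \<union> ?G l)) * \<theta> \<le> (real (card (?F l)) + real (card (?G l))) * \<theta>"
      using card_Un_le[of "?F l" "?G l"] \<theta>0 by (intro mult_right_mono) linarith+
    also have "\<dots> \<le> 2 * real m"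
      using card_large_fibers(2)[OF S(1)[OF l] \<theta>0, of fst] card_large_fibers(2)[OF S(1)[OF l] \<theta>0, of snd] S(2)[OF l]
      by (simp add: distrib_right)
    finally show "real (card (?F l \<union> ?G l)) * \<theta> \<le> 2 * real m" .
  qed
  also have "\<dots> \<le> real (k ^ 2) * (2 * real m)"
    unfolding sum_constant by (intro mult_right_mono of_nat_mono card_clique_edges_le) simp
  finally show "real (card ?V) * \<theta> \<le> 2 * real k ^ 2 * real m" by simp
qed

text \<open>Rounding a real number that is at least 1 down to an integer loses less than a factor
  2.\<close>

lemma
  assumes "k > 0" "p > 0"
  shows side_pos: "1 \<le> side k p" and side_power_le: "side k p ^ k \<le> p"
    and root_le_side: "root k (real p) \<le> 2 * real (side k p)"
    and side_le: "side k p \<le> p"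
proof -
  have r: "1 \<le> root k (real p)" using assms by (simp add: real_root_ge_1_iff)
  then show one: "1 \<le> side k p" unfolding side_def by (simp add: le_nat_floor)
  have le: "real (side k p) \<le> root k (real p)" unfolding side_def using r by simp
  have "real (side k p) ^ k \<le> root k (real p) ^ k" using le by (intro power_mono) auto
  also have "\<dots> = real p" using assms by simp
  finally show pw: "side k p ^ k \<le> p" by (simp flip: of_nat_power of_nat_le_iff)
  have "root k (real p) < real (side k p) + 1" unfolding side_def using r by linarith
  then show "root k (real p) \<le> 2 * real (side k p)" using one by simp
  have "side k p \<le> side k p ^ k" using one \<open>k > 0\<close> by (intro self_le_power) auto
  then show "side k p \<le> p" using pw by linarith
qed

lemma buckets_pos:
  assumes "k > 0" "p > 0"
  shows "0 < buckets k p" "buckets k p \<le> side k p" "side k p \<le> 2 * buckets k p"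
  using side_pos[OF assms] by (auto simp: buckets_def)

section \<open>Correctness\<close>

locale clique_input =
  fixes k p n m :: nat and S :: relations
  assumes k: "3 \<le> k" and p: "1 \<le> p" and m: "1 \<le> m"
    and inst: "clique_instance k n m S"
begin

abbreviation "q \<equiv> statistics_of k p n m S"
abbreviation "I \<equiv> input_tuples k S"
abbreviation "Listed \<equiv> listed p q"
abbreviation "Dense \<equiv> dense k p q"

lemma statistics [simp]: "domain_size q = n" "relation_size q = m"
  by (simp_all add: statistics_of_def)

lemma clique_edgeD: "(i, j) \<in> clique_edges k \<Longrightarrow> i \<in> {1..k} \<and> j \<in> {1..k} \<and> i < j"
  by (auto simp: clique_edges_def)

lemma relation: "(i, j) \<in> clique_edges k \<Longrightarrow> S i j \<subseteq> {1..n} \<times> {1..n} \<and> card (S i j) = m"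
  using inst unfolding clique_instance_def by auto

lemma finite_relation: "(i, j) \<in> clique_edges k \<Longrightarrow> finite (S i j)"
  using relation finite_subset[of "S i j" "{1..n} \<times> {1..n}"] by auto

lemma I_cases:
  assumes "\<tau> \<in> I"
  obtains i j x y where "\<tau> = ((i, j), (x, y))" "(i, j) \<in> clique_edges k" "(x, y) \<in> S i j"
    "i \<in> {1..k}" "j \<in> {1..k}" "i < j" "x \<in> {1..n}" "y \<in> {1..n}"
proof -
  obtain i j x y where \<tau>: "\<tau> = ((i, j), (x, y))" "(i, j) \<in> clique_edges k" "(x, y) \<in> S i j"
    using assms unfolding input_tuples_def by auto
  then show thesis
    using that[OF \<tau>] clique_edgeD[OF \<tau>(2)] relation[OF \<tau>(2)] by auto
qed

lemma items_I: "\<tau> \<in> I \<Longrightarrow> (\<sigma>, \<tau>) \<in> items k n"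
  by (erule I_cases) (simp add: items_def)

lemma finite_I: "finite I"
proof -
  have "Pair True ` I \<subseteq> items k n" using items_I by auto
  then show ?thesis
    using finite_subset[OF _ finite_items] by (blast intro: finite_imageD inj_onI)
qed

lemma endpoint_I:
  assumes "\<tau> \<in> I"
  shows "fst (endpoint \<sigma> \<tau>) \<in> {1..k}" "snd (endpoint \<sigma> \<tau>) \<in> {1..n}"
    "fst (endpoint False \<tau>) < fst (endpoint True \<tau>)" "link (endpoint False \<tau>) (endpoint True \<tau>) = \<tau>"
  using assms by (auto elim!: I_cases simp: endpoint_def link_def)

text \<open>This places the density threshold in the range where the statistics are complete; it
  rests on \<open>side k p \<le> p\<close>.\<close>

lemma dense_threshold: "real m / real p \<le> 4 * real k ^ 2 * real m / real (side k p)"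
proof -
  have s: "1 \<le> side k p" "side k p \<le> p" using side_pos side_le k p by auto
  then have "real m / real p \<le> real m / real (side k p)"
    by (intro divide_left_mono) auto
  also have "\<dots> \<le> 4 * real k ^ 2 * real m / real (side k p)"
  proof (rule divide_right_mono)
    have "1 \<le> real k ^ 2" using k by simp
    then show "real m \<le> 4 * real k ^ 2 * real m" using mult_right_mono[of 1 "4 * real k ^ 2" "real m"] by simp
  qed simp
  finally show ?thesis .
qed

lemma dense_imp_listed: "Dense e \<Longrightarrow> Listed e"
  using heavy_mono[OF _ dense_threshold] by (simp add: dense_def listed_def)

lemma
  shows finite_dense: "finite {v. Dense (i, v)}" and card_dense: "card {v. Dense (i, v)} \<le> side k p div 2"
proof -
  let ?V = "{v. Dense (i, v)}" and ?\<theta> = "4 * real k ^ 2 * real m / real (side k p)"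
  show "finite ?V"
    using finite_heavy[OF inst dense_threshold] by (simp add: dense_def)
  have "real (card ?V) * ?\<theta> \<le> 2 * real k ^ 2 * real m"
    using card_heavy[OF inst dense_threshold] by (simp add: dense_def)
  moreover have "0 < 2 * real k ^ 2 * real m" "0 < real (side k p)"
    using k m side_pos[of k p] p by auto
  moreover have "real (card ?V) * ?\<theta> = (2 * real (card ?V) / real (side k p)) * (2 * real k ^ 2 * real m)"
    by simp
  ultimately have "2 * real (card ?V) / real (side k p) \<le> 1"
    by (simp only: mult_le_cancel_right2)
  then have "2 * card ?V \<le> side k p"
    using \<open>0 < real (side k p)\<close> by (simp add: field_simps)
  then show "card ?V \<le> side k p div 2" by simp
qed

lemma finite_cells: "finite (cells k p q)"
  unfolding cells_def using finite_dense by (intro finite_PiE) auto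

text \<open>An attribute has at most \<open>buckets k p + side k p div 2 = side k p\<close> colours,
  and \<open>side k p ^ k \<le> p\<close>.\<close>

lemma card_cells: "card (cells k p q) \<le> p"
proof -
  have "card (cells k p q) = (\<Prod>i\<in>{1..k}. card (Inl ` {..<buckets k p} \<union> Inr ` {v. Dense (i, v)}))"
    unfolding cells_def by (rule card_PiE) simp
  also have "\<dots> \<le> (\<Prod>i\<in>{1..k}. side k p)"
  proof (intro prod_mono conjI)
    fix i
    have "card (Inl ` {..<buckets k p} \<union> Inr ` {v. Dense (i, v)}) \<le> buckets k p + card {v. Dense (i, v)}"
      using card_Un_le[of "Inl ` {..<buckets k p}" "Inr ` {v. Dense (i, v)}"] finite_dense
      by (simp add: card_image)
    also have "\<dots> \<le> side k p" using card_dense[of i] by (simp add: buckets_def)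
    finally show "card (Inl ` {..<buckets k p} \<union> Inr ` {v. Dense (i, v)}) \<le> side k p" .
  qed simp
  also have "\<dots> \<le> p" using side_power_le[of k p] k p by simp
  finally show ?thesis .
qed

lemma cell_host:
  assumes "\<kappa> \<in> cells k p q"
  obtains s where "s < p" "cell k p q s = \<kappa>"
proof
  show "to_nat_on (cells k p q) \<kappa> < p"
    using bij_betwE[OF to_nat_on_finite[OF finite_cells]] assms card_cells by fastforce
  show "cell k p q (to_nat_on (cells k p q) \<kappa>) = \<kappa>"
    unfolding cell_def using assms finite_cells by (simp add: countable_finite)
qed

lemma cell_in_cells: "cell k p q s \<in> cells k p q"
proof -
  have "buckets k p \<noteq> 0" using side_pos[of k p] k p by (simp add: buckets_def)
  then have "cells k p q \<noteq> {}" by (auto simp: cells_def PiE_eq_empty_iff lessThan_empty_iff)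
  then show ?thesis unfolding cell_def by (rule from_nat_into)
qed

end

section \<open>Messages and knowledge for fixed hash functions\<close>

locale clique_run = clique_input +
  fixes D :: "nat \<Rightarrow> labelled_tuple set" and H G :: hash
  assumes part: "evenly_partitioned p (input_tuples k S) D"
    and seed: "(H, G) \<in> set_pmf (hashes k p (statistics_of k p n m S))"
begin

abbreviation "A \<equiv> two_round_join k"
abbreviation "\<omega> \<equiv> to_nat_on (set_pmf (hashes k p q)) (H, G)"
abbreviation "view r s \<equiv> view_after A p q D \<omega> r s"

lemma D: "(\<Union>s<p. D s) = I" "\<lbrakk>s < p; \<tau> \<in> D s\<rbrakk> \<Longrightarrow> \<tau> \<in> I"
    "\<lbrakk>s < p; t < p; \<tau> \<in> D s; \<tau> \<in> D t\<rbrakk> \<Longrightarrow> s = t"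
  using part unfolding evenly_partitioned_def disjoint_family_on_def by blast+

lemma hash_values:
  assumes "i \<in> {1..k}" "v \<in> {1..n}"
  shows "H i v < p" "G i v < buckets k p"
proof -
  have "H \<in> set_pmf (Pi_pmf {1..k} (\<lambda>_. 0) (\<lambda>_. uniform_hash {1..n} p))"
    "G \<in> set_pmf (Pi_pmf {1..k} (\<lambda>_. 0) (\<lambda>_. uniform_hash {1..n} (buckets k p)))"
    using seed by (auto simp: hashes_def)
  then have "H i \<in> set_pmf (uniform_hash {1..n} p)" "G i \<in> set_pmf (uniform_hash {1..n} (buckets k p))"
    using assms(1) by (auto simp: set_Pi_pmf PiE_dflt_def)
  then have "H i v \<in> set_pmf (pmf_of_set {..<p})" "G i v \<in> set_pmf (pmf_of_set {..<buckets k p})"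
    using assms(2) by (auto simp: set_Pi_pmf PiE_dflt_def)
  moreover have "0 < buckets k p"
    using side_pos[of k p] k p by (simp add: buckets_def)
  ultimately show "H i v < p" "G i v < buckets k p"
    using p by (auto simp: set_pmf_of_set lessThan_empty_iff)
qed

lemma hash_endpoint: "\<tau> \<in> I \<Longrightarrow> case_prod H (endpoint \<sigma> \<tau>) < p"
  using hash_values(1)[OF endpoint_I(1,2)] by (simp add: case_prod_unfold)

lemma seed_decode [simp]: "from_nat_into (set_pmf (hashes k p q)) \<omega> = (H, G)"
  using seed by (rule from_nat_into_to_nat_on[OF countable_set_pmf])

definition sent1 :: "nat \<Rightarrow> nat \<Rightarrow> labelled_tuple set" where
  "sent1 s t = first_round p q H (D s) t"

text \<open>The outcome of the first round at server \<open>t\<close>, described independently of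
  how \<open>D\<close> distributes the tuples; \<open>K2\<close> does the same for the second
  round.\<close>

definition K1 :: "nat \<Rightarrow> labelled_tuple set" where
  "K1 t = {\<tau> \<in> I. (\<forall>\<sigma>. Listed (endpoint \<sigma> \<tau>)) \<or>
             (\<exists>\<sigma>. \<not> Listed (endpoint \<sigma> \<tau>) \<and> case_prod H (endpoint \<sigma> \<tau>) = t)}"

definition sent2 :: "nat \<Rightarrow> nat \<Rightarrow> (bool \<times> labelled_tuple) set" where
  "sent2 s t = second_round k p q (H, G) s (D s) (K1 s) t"

definition K2 :: "nat \<Rightarrow> (bool \<times> labelled_tuple) set" where
  "K2 t = {(\<sigma>, \<tau>). \<tau> \<in> I \<and>
     (\<forall>\<rho>. \<not> Dense (endpoint \<rho> \<tau>) \<and>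
          cell k p q t (fst (endpoint \<rho> \<tau>)) = Inl (case_prod G (endpoint \<rho> \<tau>))) \<and>
     (\<forall>u\<in>{1..k}. \<forall>v. cell k p q t u = Inr v \<longrightarrow> link (u, v) (endpoint \<sigma> \<tau>) \<in> I)}"

lemma K1_subset: "K1 t \<subseteq> I" by (auto simp: K1_def)

lemma UN_sent1: "(\<Union>s<p. sent1 s t) = K1 t"
proof -
  have "sent1 s t = D s \<inter> K1 t" if "s < p" for s
    using D(2)[OF that] by (auto simp: sent1_def first_round_def K1_def)
  then have "(\<Union>s<p. sent1 s t) = (\<Union>s<p. D s) \<inter> K1 t" by auto
  then show ?thesis using D(1) K1_subset[of t] by (metis inf.absorb2)
qed

lemma sent1_items: "s < p \<Longrightarrow> Pair False ` sent1 s t \<subseteq> items k n"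
proof -
  assume "s < p"
  then have "sent1 s t \<subseteq> I" using UN_sent1[of t] K1_subset[of t] by blast
  then show ?thesis using items_I by (metis image_subset_iff subsetD)
qed

lemma send_first: "send A (view 0 s) t = encode k n (Pair False ` sent1 s t)"
  by (simp add: two_round_join_def sent1_def Let_def)

lemma received_first:
  assumes "0 < r"
  shows "snd ` received k (view r t) 0 = K1 t"
proof -
  have "received k (view r t) 0 = (\<Union>s<p. decode k n (send A (view 0 s) t))"
    using assms by (simp add: received_def inbox_view_after del: view_after.simps)
  also have "\<dots> = (\<Union>s<p. Pair False ` sent1 s t)"
    using sent1_items by (auto simp: send_first decode_encode simp del: view_after.simps)
  finally show ?thesis
    using UN_sent1 by (auto simp: image_UN image_image)
qed


text \<open>In an input tuple the attributes are strictly ordered, so \<open>a\<close> and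
  \<open>b\<close> can be recovered as its two endpoints, up to order.\<close>

lemma link_in_relation:
  assumes "link a b \<in> I"
  shows "fst a \<noteq> fst b"
    and "\<exists>\<sigma>. endpoint \<sigma> (link a b) = a \<and> endpoint (\<not> \<sigma>) (link a b) = b"
  using endpoint_I(3)[OF assms] unfolding link_def endpoint_def by (auto split: if_splits)

text \<open>The designated sender can check the semijoin condition on \<open>K1 s\<close> alone.
  Links at an unlisted endpoint were hashed to that endpoint's server, and a link from a listed
  endpoint to a dense value joins two listed values and was broadcast.\<close>

lemma UN_sent2: "(\<Union>s<p. sent2 s t) = K2 t"
proof
  show "(\<Union>s<p. sent2 s t) \<subseteq> K2 t"
    using D(2) K1_subset unfolding sent2_def second_round_def K2_def
    by (fastforce split: if_splits)
  show "K2 t \<subseteq> (\<Union>s<p. sent2 s t)"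
  proof (rule subrelI)
    fix \<sigma> \<tau> assume st: "(\<sigma>, \<tau>) \<in> K2 t"
    then have \<tau>: "\<tau> \<in> I" by (simp add: K2_def)
    let ?e = "endpoint \<sigma> \<tau>"
    obtain s where s: "s < p" "if Listed ?e then \<tau> \<in> D s else case_prod H ?e = s"
      using D(1) \<tau> hash_endpoint by (metis UN_E lessThan_iff)
    have \<tau>K: "\<tau> \<in> K1 s" if "\<not> Listed ?e"
      using s that \<tau> unfolding K1_def by auto
    have links: "link (u, v) ?e \<in> K1 s" if u: "u \<in> {1..k}" "cell k p q t u = Inr v" for u v
    proof -
      have l: "link (u, v) ?e \<in> I" using st u unfolding K2_def by auto
      show ?thesis
      proof (cases "Listed ?e")
        case False
        then show ?thesis
          using l s link_in_relation(2)[OF l] unfolding K1_def by (auto split: if_splits) metis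
      next
        case True
        have "Dense (u, v)" using u PiE_mem[OF cell_in_cells[of t, unfolded cells_def], of u] by auto
        then have uv: "Listed (u, v)" by (rule dense_imp_listed)
        obtain \<sigma>' where "endpoint \<sigma>' (link (u, v) ?e) = (u, v)" "endpoint (\<not> \<sigma>') (link (u, v) ?e) = ?e"
          using link_in_relation(2)[OF l] by blast
        then have "Listed (endpoint \<rho> (link (u, v) ?e))" for \<rho>
          using uv True by (cases "\<rho> = \<sigma>'") auto
        then show ?thesis using l unfolding K1_def by auto
      qed
    qed
    have "(\<sigma>, \<tau>) \<in> sent2 s t"
      using st s \<tau>K links unfolding sent2_def second_round_def K2_def by auto
    then show "(\<sigma>, \<tau>) \<in> (\<Union>s<p. sent2 s t)" using s by blast
  qed
qed

lemma K2_items: "K2 t \<subseteq> items k n"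
  using items_I unfolding K2_def by auto

lemma send_second: "send A (view 1 s) t = encode k n (sent2 s t)"
  using received_first[of 1 s] by (simp add: send_two_round_join sent2_def Let_def del: view_after.simps)

lemma send_later: "2 \<le> r \<Longrightarrow> send A (view r s) t = []"
  by (simp add: send_two_round_join Let_def del: view_after.simps)

lemma received_second:
  assumes "1 < r"
  shows "received k (view r t) 1 = K2 t"
proof -
  have "received k (view r t) 1 = (\<Union>s<p. decode k n (send A (view 1 s) t))"
    using assms by (simp add: received_def inbox_view_after del: view_after.simps)
  also have "\<dots> = (\<Union>s<p. sent2 s t)"
  proof (rule SUP_cong[OF refl])
    fix s assume "s \<in> {..<p}"
    then have "sent2 s t \<subseteq> items k n" using UN_sent2[of t] K2_items[of t] by blast
    then show "decode k n (send A (view 1 s) t) = sent2 s t" unfolding send_second by (rule decode_encode)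
  qed
  finally show ?thesis by (simp only: UN_sent2)
qed

section \<open>Every answer is assembled at some server\<close>

definition K :: "nat \<Rightarrow> labelled_tuple set" where
  "K s = K1 s \<union> snd ` K2 s \<union>
     {link (u, h) (endpoint \<sigma> \<tau>) | u h \<sigma> \<tau>. (\<sigma>, \<tau>) \<in> K2 s \<and> u \<in> {1..k} \<and> cell k p q s u = Inr h}"

text \<open>Soundness: the links added without being received lie in the input by the semijoin
  condition in \<open>K2\<close>.\<close>

lemma K_subset: "K s \<subseteq> I"
  using K1_subset unfolding K_def K2_def by auto

lemma result_eq:
  "result A (view (k - 1) s) =
     {x \<in> {1..k} \<rightarrow>\<^sub>E {1..n}. \<forall>(i, j) \<in> clique_edges k. ((i, j), (x i, x j)) \<in> K s}"
proof -
  have "0 < k - 1" "1 < k - 1" using k by auto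
  then have "known k (view (k - 1) s) = K s"
    unfolding known_def K_def using received_first received_second by simp
  then show ?thesis by (simp add: two_round_join_def del: view_after.simps)
qed

text \<open>If at most one value of the answer is light, the hash server of that value knows
  everything after the first round. Otherwise the server of the answer's colour vector does: dense
  pairs were broadcast, light pairs are received, and mixed pairs are certified by light
  ones.\<close>

lemma known_somewhere:
  assumes x: "x \<in> {1..k} \<rightarrow>\<^sub>E {1..n}"
    and ans: "\<And>i j. (i, j) \<in> clique_edges k \<Longrightarrow> ((i, j), (x i, x j)) \<in> I"
  shows "\<exists>s<p. \<forall>(i, j) \<in> clique_edges k. ((i, j), (x i, x j)) \<in> K s"
proof (cases "\<exists>i0\<in>{1..k}. \<forall>i\<in>{1..k} - {i0}. Dense (i, x i)")
  case True
  then obtain i0 where i0: "i0 \<in> {1..k}" "\<And>i. i \<in> {1..k} \<Longrightarrow> i \<noteq> i0 \<Longrightarrow> Listed (i, x i)"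
    using dense_imp_listed by auto
  have xi0: "x i0 \<in> {1..n}" using x i0 by auto
  have "((i, j), (x i, x j)) \<in> K1 (H i0 (x i0))" if ij: "(i, j) \<in> clique_edges k" for i j
  proof -
    have e: "endpoint \<sigma> ((i, j), (x i, x j)) = (if \<sigma> then (j, x j) else (i, x i))" for \<sigma>
      by (simp add: endpoint_def)
    \<comment> \<open>If the remaining value is listed too, all tuples of the answer were broadcast,
      and its hash server is just some witness.\<close>
    have "(\<forall>\<sigma>. Listed (endpoint \<sigma> ((i, j), (x i, x j)))) \<or>
      (\<exists>\<sigma>. \<not> Listed (endpoint \<sigma> ((i, j), (x i, x j))) \<and> case_prod H (endpoint \<sigma> ((i, j), (x i, x j))) = H i0 (x i0))"
      unfolding e using i0(2)[of i] i0(2)[of j] clique_edgeD[OF ij] by (cases "Listed (i0, x i0)") (auto split: if_splits)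
    then show ?thesis using ans[OF ij] by (simp add: K1_def)
  qed
  then show ?thesis
    using hash_values(1)[OF i0(1) xi0] unfolding K_def by blast
next
  case False
  define \<kappa> where "\<kappa> = (\<lambda>i\<in>{1..k}. if Dense (i, x i) then Inr (x i) else Inl (G i (x i)))"
  have "\<kappa> \<in> cells k p q"
    unfolding cells_def \<kappa>_def using x hash_values(2) by (auto simp: PiE_iff)
  then obtain s where s: "s < p" "cell k p q s = \<kappa>" by (rule cell_host)
  have linkI: "link (i, x i) (j, x j) \<in> I" if "i \<in> {1..k}" "j \<in> {1..k}" "i \<noteq> j" for i j
    using ans[of i j] ans[of j i] that by (auto simp: link_def clique_edges_def)
  have light: "(\<sigma>, \<tau>) \<in> K2 s"
    if i: "i \<in> {1..k}" "\<not> Dense (i, x i)" and j: "j \<in> {1..k}" "\<not> Dense (j, x j)" and ij: "i \<noteq> j"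
      and \<tau>: "\<tau> = link (i, x i) (j, x j)" for i j \<sigma> \<tau>
  proof -
    have \<tau>I: "\<tau> \<in> I" using linkI that by simp
    have ends: "endpoint \<rho> \<tau> \<in> {(i, x i), (j, x j)}" for \<rho>
      unfolding \<tau> by (auto simp: link_def endpoint_def)
    \<comment> \<open>The dense values in \<open>\<kappa>\<close> are values of the answer itself,
      so their links are tuples of the answer.\<close>
    have "link (u, v) (endpoint \<sigma> \<tau>) \<in> I" if "u \<in> {1..k}" "\<kappa> u = Inr v" for u v
    proof -
      have v: "v = x u" "Dense (u, x u)" using that by (auto simp: \<kappa>_def split: if_splits)
      then have "u \<noteq> i" "u \<noteq> j" using i j by auto
      then show ?thesis using ends[of \<sigma>] linkI that v i j by auto
    qed
    moreover have "\<not> Dense (endpoint \<rho> \<tau>) \<and> \<kappa> (fst (endpoint \<rho> \<tau>)) = Inl (case_prod G (endpoint \<rho> \<tau>))" for \<rho>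
      using ends[of \<rho>] i j by (auto simp: \<kappa>_def)
    ultimately show ?thesis using \<tau>I s by (simp add: K2_def)
  qed
  have mixed: "link (u, x u) (i, x i) \<in> K s"
    if i: "i \<in> {1..k}" "\<not> Dense (i, x i)" and u: "u \<in> {1..k}" "Dense (u, x u)" for i u
  proof -
    \<comment> \<open>A second light value exists in this case; it supplies a light pair whose flag
      can point at \<open>i\<close>.\<close>
    obtain j where j: "j \<in> {1..k}" "j \<noteq> i" "\<not> Dense (j, x j)" using False i by blast
    let ?\<tau> = "link (i, x i) (j, x j)"
    obtain \<sigma> where \<sigma>: "endpoint \<sigma> ?\<tau> = (i, x i)"
      using link_in_relation(2)[OF linkI] i j by metis
    have "(\<sigma>, ?\<tau>) \<in> K2 s" using light i j by auto
    moreover have "cell k p q s u = Inr (x u)" using u s by (simp add: \<kappa>_def)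
    ultimately have "link (u, x u) (endpoint \<sigma> ?\<tau>) \<in> K s" using u(1) unfolding K_def by blast
    then show ?thesis using \<sigma> by simp
  qed
  have "((i, j), (x i, x j)) \<in> K s" if ij: "(i, j) \<in> clique_edges k" for i j
  proof -
    have r: "i \<in> {1..k}" "j \<in> {1..k}" "i < j" using clique_edgeD[OF ij] by auto
    then have eq: "((i, j), (x i, x j)) = link (i, x i) (j, x j)" "link (i, x i) (j, x j) = link (j, x j) (i, x i)"
      by (auto simp: link_def)
    consider "Dense (i, x i)" "Dense (j, x j)" | "\<not> Dense (i, x i)" "\<not> Dense (j, x j)"
      | "Dense (i, x i)" "\<not> Dense (j, x j)" | "\<not> Dense (i, x i)" "Dense (j, x j)" by blast
    then show ?thesis
    proof cases
      case 1
      then have "((i, j), (x i, x j)) \<in> K1 s"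
        using ans[OF ij] dense_imp_listed by (simp add: K1_def endpoint_def)
      then show ?thesis by (simp add: K_def)
    next
      case 2
      then have "(True, link (i, x i) (j, x j)) \<in> K2 s" using light r by auto
      then show ?thesis unfolding eq(1) K_def by force
    next
      case 3
      then show ?thesis unfolding eq(1) using mixed r by simp
    next
      case 4
      then show ?thesis unfolding eq using mixed r by simp
    qed
  qed
  then show ?thesis using s(1) by blast
qed

lemma union_of_outputs_eq: "union_of_outputs A p q D \<omega> (k - 1) = clique_answers k n S"
proof -
  have inI: "((i, j), u) \<in> I \<longleftrightarrow> u \<in> S i j" if "(i, j) \<in> clique_edges k" for i j u
    using that by (simp add: input_tuples_def)
  show ?thesis
  proof
    show "union_of_outputs A p q D \<omega> (k - 1) \<subseteq> clique_answers k n S"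
      unfolding union_of_outputs_def result_eq clique_answers_def using K_subset inI by fast
    show "clique_answers k n S \<subseteq> union_of_outputs A p q D \<omega> (k - 1)"
    proof
      fix x assume "x \<in> clique_answers k n S"
      then have x: "x \<in> {1..k} \<rightarrow>\<^sub>E {1..n}" and "\<And>i j. (i, j) \<in> clique_edges k \<Longrightarrow> ((i, j), (x i, x j)) \<in> I"
        using inI unfolding clique_answers_def by auto
      from known_somewhere[OF this] x show "x \<in> union_of_outputs A p q D \<omega> (k - 1)"
        unfolding union_of_outputs_def result_eq by auto
    qed
  qed
qed

end

section \<open>Load\<close>

text \<open>For the average load \<open>m / p\<close> of one hashed column, some server receives
  more than \<open>T\<close> times as much.\<close>

definition overloaded1 ::
  "nat \<Rightarrow> nat \<Rightarrow> clique_statistics \<Rightarrow> relations \<Rightarrow> real \<Rightarrow> hash \<Rightarrow> bool" where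
  "overloaded1 k p q S T H \<longleftrightarrow> (\<exists>l\<in>clique_edges k. \<exists>\<sigma>. \<exists>s<p.
     T * (real (relation_size q) / real p) < real (card {r \<in> S (fst l) (snd l).
       \<not> listed p q (endpoint \<sigma> (l, r)) \<and> case_prod H (endpoint \<sigma> (l, r)) = s}))"

text \<open>The factor \<open>4 * real k ^ 2\<close> is inherited from the density threshold and is
  the \<open>K\<close> of \<open>grid_tail\<close>.\<close>

definition overloaded2 ::
  "nat \<Rightarrow> nat \<Rightarrow> clique_statistics \<Rightarrow> relations \<Rightarrow> real \<Rightarrow> hash \<Rightarrow> bool" where
  "overloaded2 k p q S T G \<longleftrightarrow> (\<exists>l\<in>clique_edges k. \<exists>\<alpha><buckets k p. \<exists>\<beta><buckets k p.
     4 * real k ^ 2 * T ^ 2 * real (relation_size q) / real (buckets k p) ^ 2 <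
     real (card {r \<in> {r \<in> S (fst l) (snd l). \<forall>\<sigma>. \<not> dense k p q (endpoint \<sigma> (l, r))}.
       G (fst l) (fst r) = \<alpha> \<and> G (snd l) (snd r) = \<beta>}))"

section \<open>Load in the absence of overload\<close>

context clique_run begin

lemma finite_sent1: "s < p \<Longrightarrow> finite (sent1 s t)"
  using UN_sent1[of t] K1_subset[of t] finite_I by (metis UN_upper finite_subset lessThan_iff)

lemma finite_K2: "finite (K2 t)"
  using K2_items finite_items by (rule finite_subset)

text \<open>Each tuple has one owner, so a server never receives it twice and the message sizes add
  up to the size of the union.\<close>

lemma bits_first: "bits_received A p q D \<omega> 0 t = item_width k n * card (K1 t)"
proof -
  have "bits_received A p q D \<omega> 0 t = (\<Sum>s<p. item_width k n * card (sent1 s t))"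
    unfolding bits_received_def send_first
    by (intro sum.cong refl) (simp add: length_encode sent1_items card_image inj_on_def)
  also have "\<dots> = item_width k n * card (\<Union>s<p. sent1 s t)"
    unfolding sum_distrib_left[symmetric]
  proof (subst card_UN_disjoint)
    show "\<forall>s\<in>{..<p}. \<forall>s'\<in>{..<p}. s \<noteq> s' \<longrightarrow> sent1 s t \<inter> sent1 s' t = {}"
      using D(3) unfolding sent1_def first_round_def by blast
  qed (use finite_sent1 in auto)
  finally show ?thesis by (simp only: UN_sent1)
qed

text \<open>Each flagged item has one sender, its owner or the hash server of the flagged endpoint,
  so again nothing arrives twice.\<close>

lemma bits_second: "bits_received A p q D \<omega> 1 t = item_width k n * card (K2 t)"
proof -
  have sub: "sent2 s t \<subseteq> K2 t" if "s < p" for s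
    using that UN_sent2[of t] by blast
  have "bits_received A p q D \<omega> 1 t = (\<Sum>s<p. item_width k n * card (sent2 s t))"
    unfolding bits_received_def send_second
    by (intro sum.cong refl length_encode) (use sub K2_items in blast)
  also have "\<dots> = item_width k n * card (\<Union>s<p. sent2 s t)"
    unfolding sum_distrib_left[symmetric]
  proof (subst card_UN_disjoint)
    have "s = s'" if "s < p" "s' < p" "(\<sigma>, \<tau>) \<in> sent2 s t" "(\<sigma>, \<tau>) \<in> sent2 s' t" for s s' \<sigma> \<tau>
      using that D(3)[of s s' \<tau>] unfolding sent2_def second_round_def by (auto split: if_splits)
    then show "\<forall>s\<in>{..<p}. \<forall>s'\<in>{..<p}. s \<noteq> s' \<longrightarrow> sent2 s t \<inter> sent2 s' t = {}"
      by fast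
    show "\<forall>s\<in>{..<p}. finite (sent2 s t)" using sub finite_K2 finite_subset by blast
  qed auto
  finally show ?thesis by (simp only: UN_sent2)
qed

lemma bits_later: "2 \<le> r \<Longrightarrow> bits_received A p q D \<omega> r t = 0"
  unfolding bits_received_def by (simp add: send_later)

lemma card_listed: "real (card {v. Listed (i, v)}) \<le> 2 * real k ^ 2 * real p"
  and finite_listed: "finite {v. Listed (i, v)}"
proof -
  have "real (card {v. Listed (i, v)}) * (real m / real p) \<le> 2 * real k ^ 2 * real m"
    using card_heavy[OF inst order_refl] by (simp add: listed_def)
  also have "\<dots> = (2 * real k ^ 2 * real p) * (real m / real p)" using p by simp
  finally show "real (card {v. Listed (i, v)}) \<le> 2 * real k ^ 2 * real p"
    by (rule mult_right_le_imp_le) (use m p in auto)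
  show "finite {v. Listed (i, v)}"
    using finite_heavy[OF inst order_refl] by (simp add: listed_def)
qed

text \<open>Per relation, a broadcast tuple is a pair out of at most
  \<open>2 * real k ^ 2 * real p\<close> listed values per attribute, and the hashed tuples arrive
  through at most two endpoints.\<close>

lemma card_K1:
  assumes "t < p" "\<not> overloaded1 k p q S T H"
  shows "real (card (K1 t)) \<le> real k ^ 2 * (4 * real k ^ 4 * real p ^ 2 + 2 * (T * (real m / real p)))"
proof -
  let ?L = "\<lambda>l. {r \<in> S (fst l) (snd l). \<forall>\<sigma>. Listed (endpoint \<sigma> (l, r))}"
  let ?N = "\<lambda>l \<sigma>. {r \<in> S (fst l) (snd l). \<not> Listed (endpoint \<sigma> (l, r)) \<and> case_prod H (endpoint \<sigma> (l, r)) = t}"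
  have sub: "K1 t \<subseteq> (\<Union>l\<in>clique_edges k. Pair l ` (?L l \<union> (\<Union>\<sigma>. ?N l \<sigma>)))"
  proof
    fix \<tau> assume "\<tau> \<in> K1 t"
    then have \<tau>: "\<tau> \<in> I" "(\<forall>\<sigma>. Listed (endpoint \<sigma> (fst \<tau>, snd \<tau>))) \<or>
        (\<exists>\<sigma>. \<not> Listed (endpoint \<sigma> (fst \<tau>, snd \<tau>)) \<and> case_prod H (endpoint \<sigma> (fst \<tau>, snd \<tau>)) = t)"
      by (simp_all add: K1_def)
    from \<tau>(1) have l: "fst \<tau> \<in> clique_edges k" "snd \<tau> \<in> S (fst (fst \<tau>)) (snd (fst \<tau>))"
      by (auto simp: input_tuples_def)
    then have "snd \<tau> \<in> ?L (fst \<tau>) \<union> (\<Union>\<sigma>. ?N (fst \<tau>) \<sigma>)" using \<tau>(2) by blast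
    then have "(fst \<tau>, snd \<tau>) \<in> (\<Union>l\<in>clique_edges k. Pair l ` (?L l \<union> (\<Union>\<sigma>. ?N l \<sigma>)))"
      using l(1) by blast
    then show "\<tau> \<in> (\<Union>l\<in>clique_edges k. Pair l ` (?L l \<union> (\<Union>\<sigma>. ?N l \<sigma>)))" by simp
  qed
  have bound: "real (card (Pair l ` (?L l \<union> (\<Union>\<sigma>. ?N l \<sigma>))))
      \<le> 4 * real k ^ 4 * real p ^ 2 + 2 * (T * (real m / real p))" if l: "l \<in> clique_edges k" for l
  proof -
    have "?L l \<subseteq> {v. Listed (fst l, v)} \<times> {v. Listed (snd l, v)}"
    proof
      fix r assume r: "r \<in> ?L l"
      then have "Listed (endpoint False (l, r))" "Listed (endpoint True (l, r))" by blast+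
      then show "r \<in> {v. Listed (fst l, v)} \<times> {v. Listed (snd l, v)}"
        by (cases r) (simp add: endpoint_def)
    qed
    then have "card (?L l) \<le> card ({v. Listed (fst l, v)} \<times> {v. Listed (snd l, v)})"
      using finite_listed by (intro card_mono) auto
    also have "real \<dots> = real (card {v. Listed (fst l, v)}) * real (card {v. Listed (snd l, v)})"
      by (simp add: card_cartesian_product)
    also have "\<dots> \<le> (2 * real k ^ 2 * real p) * (2 * real k ^ 2 * real p)"
      using card_listed by (intro mult_mono) auto
    also have "\<dots> = 4 * real k ^ 4 * real p ^ 2"
      by (simp add: power2_eq_square power4_eq_xxxx)
    finally have 1: "real (card (?L l)) \<le> 4 * real k ^ 4 * real p ^ 2" by simp
    have "real (card (?N l \<sigma>)) \<le> T * (real m / real p)" for \<sigma>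
      using assms l unfolding overloaded1_def statistics by (meson leI)
    then have 2: "real (card (\<Union>\<sigma>. ?N l \<sigma>)) \<le> 2 * (T * (real m / real p))"
      using card_UN_bound[of "UNIV :: bool set" "?N l" "T * (real m / real p)"] by (simp add: card_UNIV_bool)
    have "card (Pair l ` (?L l \<union> (\<Union>\<sigma>. ?N l \<sigma>))) = card (?L l \<union> (\<Union>\<sigma>. ?N l \<sigma>))"
      by (intro card_image inj_onI) auto
    also have "\<dots> \<le> card (?L l) + card (\<Union>\<sigma>. ?N l \<sigma>)" by (rule card_Un_le)
    finally show ?thesis using 1 2 by linarith
  qed
  have finS: "finite (S (fst l) (snd l))" if "l \<in> clique_edges k" for l
    using that finite_relation by (metis prod.collapse)
  have "card (K1 t) \<le> card (\<Union>l\<in>clique_edges k. Pair l ` (?L l \<union> (\<Union>\<sigma>. ?N l \<sigma>)))"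
    using finS finite_clique_edges by (intro card_mono[OF _ sub]) auto
  also have "real \<dots> \<le> real (card (clique_edges k)) * (4 * real k ^ 4 * real p ^ 2 + 2 * (T * (real m / real p)))"
    by (rule card_UN_bound[OF finite_clique_edges bound])
  also have "\<dots> \<le> real k ^ 2 * (4 * real k ^ 4 * real p ^ 2 + 2 * (T * (real m / real p)))"
  proof (rule mult_right_mono)
    show "real (card (clique_edges k)) \<le> real k ^ 2"
      using card_clique_edges_le[of k] by (simp flip: of_nat_power)
    have "(1, 2) \<in> clique_edges k" using k by (simp add: clique_edges_def)
    from bound[OF this] show "0 \<le> 4 * real k ^ 4 * real p ^ 2 + 2 * (T * (real m / real p))"
      by (rule order_trans[rotated]) simp
  qed
  finally show ?thesis by simp
qed

text \<open>The cell of \<open>t\<close> selects at most one grid square of each relation; the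
  factor 2 counts the two flags.\<close>

lemma card_K2:
  assumes "\<not> overloaded2 k p q S T G"
  shows "real (card (K2 t)) \<le> real k ^ 2 * (2 * (4 * real k ^ 2 * T ^ 2 * real m / real (buckets k p) ^ 2))"
proof -
  let ?c = "4 * real k ^ 2 * T ^ 2 * real m / real (buckets k p) ^ 2"
  let ?R = "\<lambda>l. {r \<in> {r \<in> S (fst l) (snd l). \<forall>\<sigma>. \<not> Dense (endpoint \<sigma> (l, r))}.
       cell k p q t (fst l) = Inl (G (fst l) (fst r)) \<and> cell k p q t (snd l) = Inl (G (snd l) (snd r))}"
  have finS: "finite (S (fst l) (snd l))" if "l \<in> clique_edges k" for l
    using that finite_relation by (metis prod.collapse)
  have sub: "K2 t \<subseteq> UNIV \<times> (\<Union>l\<in>clique_edges k. Pair l ` ?R l)"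
  proof (rule subrelI)
    fix \<sigma> \<tau> assume st: "(\<sigma>, \<tau>) \<in> K2 t"
    then have "\<tau> \<in> I" by (simp add: K2_def)
    then have l: "fst \<tau> \<in> clique_edges k" "snd \<tau> \<in> S (fst (fst \<tau>)) (snd (fst \<tau>))"
      by (auto simp: input_tuples_def)
    have *: "\<not> Dense (endpoint \<rho> (fst \<tau>, snd \<tau>))"
      "cell k p q t (fst (endpoint \<rho> \<tau>)) = Inl (case_prod G (endpoint \<rho> \<tau>))" for \<rho>
      using st by (auto simp: K2_def)
    have "cell k p q t (fst (fst \<tau>)) = Inl (G (fst (fst \<tau>)) (fst (snd \<tau>)))"
      "cell k p q t (snd (fst \<tau>)) = Inl (G (snd (fst \<tau>)) (snd (snd \<tau>)))"
      using *(2)[of False] *(2)[of True] by (simp_all add: endpoint_def)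
    then have "snd \<tau> \<in> ?R (fst \<tau>)" using l(2) *(1) by blast
    then have "(fst \<tau>, snd \<tau>) \<in> (\<Union>l\<in>clique_edges k. Pair l ` ?R l)" using l(1) by blast
    then show "(\<sigma>, \<tau>) \<in> UNIV \<times> (\<Union>l\<in>clique_edges k. Pair l ` ?R l)"
      by simp
  qed
  have c: "0 \<le> ?c" by (intro divide_nonneg_nonneg mult_nonneg_nonneg) auto
  have bound: "real (card (Pair l ` ?R l)) \<le> ?c" if l: "l \<in> clique_edges k" for l
  proof (cases "?R l = {}")
    case True
    show ?thesis unfolding True using c by simp
  next
    case False
    \<comment> \<open>A single member shows that both colours of the cell at \<open>l\<close> are
      buckets and names them.\<close>
    then obtain r where r: "r \<in> ?R l" by blast
    define \<alpha> \<beta> where "\<alpha> = G (fst l) (fst r)" and "\<beta> = G (snd l) (snd r)"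
    have ends: "fst l \<in> {1..k}" "snd l \<in> {1..k}" "fst r \<in> {1..n}" "snd r \<in> {1..n}"
      using clique_edgeD[of "fst l" "snd l"] relation[of "fst l" "snd l"] l r by (auto simp: mem_Times_iff)
    have "?R l = {r \<in> {r \<in> S (fst l) (snd l). \<forall>\<sigma>. \<not> Dense (endpoint \<sigma> (l, r))}.
        G (fst l) (fst r) = \<alpha> \<and> G (snd l) (snd r) = \<beta>}"
      using r by (auto simp: \<alpha>_def \<beta>_def)
    note eq = this
    have "\<alpha> < buckets k p" "\<beta> < buckets k p"
      unfolding \<alpha>_def \<beta>_def using hash_values(2) ends by blast+
    then have "real (card (?R l)) \<le> ?c"
      using assms l unfolding overloaded2_def statistics eq by (meson leI)
    then show ?thesis using card_image_le[of "?R l" "Pair l"] finS[OF l] by (simp add: card_image inj_on_def)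
  qed
  have fin: "finite (\<Union>l\<in>clique_edges k. Pair l ` ?R l)"
    using finS finite_clique_edges by auto
  have UN: "real (card (\<Union>l\<in>clique_edges k. Pair l ` ?R l)) \<le> real (card (clique_edges k)) * ?c"
    by (rule card_UN_bound[OF finite_clique_edges bound])
  have "card (K2 t) \<le> card ((UNIV :: bool set) \<times> (\<Union>l\<in>clique_edges k. Pair l ` ?R l))"
    using fin by (intro card_mono[OF _ sub]) auto
  also have "\<dots> = 2 * card (\<Union>l\<in>clique_edges k. Pair l ` ?R l)"
    by (simp add: card_cartesian_product card_UNIV_bool)
  also have "real \<dots> \<le> 2 * (real (card (clique_edges k)) * ?c)"
    using UN by linarith
  also have "\<dots> \<le> 2 * (real k ^ 2 * ?c)"
    using card_clique_edges_le[of k] c by (intro mult_left_mono mult_right_mono) (simp_all flip: of_nat_power)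
  finally show ?thesis by (simp only: mult_ac)
qed

lemma load_le:
  fixes c :: real
  assumes "\<And>t. t < p \<Longrightarrow> real (card (K1 t)) \<le> c" "\<And>t. t < p \<Longrightarrow> real (card (K2 t)) \<le> c"
  shows "real (load A p q D \<omega> (k - 1)) \<le> real (item_width k n) * c"
proof -
  let ?B = "{bits_received A p q D \<omega> r s | r s. r < k - 1 \<and> s < p}"
  have "?B = (\<lambda>(r, s). bits_received A p q D \<omega> r s) ` ({..<k - 1} \<times> {..<p})" by auto
  moreover have "{..<k - 1} \<times> {..<p} \<noteq> {}" using k p by (auto simp: lessThan_empty_iff)
  ultimately have "finite ?B" "?B \<noteq> {}" by auto
  then have "load A p q D \<omega> (k - 1) \<in> ?B" unfolding load_def by (rule Max_in)
  then obtain r s where rs: "load A p q D \<omega> (k - 1) = bits_received A p q D \<omega> r s" "s < p" by blast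
  have c: "0 \<le> c" using assms(1)[OF rs(2)] by linarith
  consider "r = 0" | "r = 1" | "2 \<le> r" by linarith
  then have "real (bits_received A p q D \<omega> r s) \<le> real (item_width k n) * c"
  proof cases
    case 1
    then show ?thesis using assms(1)[OF rs(2)] by (simp add: bits_first mult_left_mono)
  next
    case 2
    then show ?thesis using assms(2)[OF rs(2)] by (simp only: bits_second of_nat_mult mult_left_mono of_nat_0_le_iff)
  next
    case 3
    then show ?thesis using c by (simp add: bits_later)
  qed
  then show ?thesis by (simp only: rs(1))
qed

end

section \<open>Probability of overload\<close>

context clique_input begin

text \<open>If some tuple over \<open>v\<close> survives the filter, then \<open>v\<close> is light
  and even its full fibre is small; otherwise the filtered fibre is empty.\<close>

lemma light_fiber_le:
  assumes l: "l \<in> clique_edges k" and \<theta>: "real m / real p \<le> \<theta>"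
  shows "real (card {r \<in> {r \<in> S (fst l) (snd l). \<not> heavy q \<theta> (endpoint \<sigma> (l, r))}. snd (endpoint \<sigma> (l, r)) = v}) \<le> \<theta>"
proof (cases "\<exists>r \<in> S (fst l) (snd l). \<not> heavy q \<theta> (endpoint \<sigma> (l, r)) \<and> snd (endpoint \<sigma> (l, r)) = v")
  case True
  then obtain r where "\<not> heavy q \<theta> (endpoint \<sigma> (l, r))" "snd (endpoint \<sigma> (l, r)) = v" by blast
  then have "real (card {r \<in> S (fst l) (snd l). snd (endpoint \<sigma> (l, r)) = v}) \<le> \<theta>"
    using l unfolding heavy_statistics_of[OF \<theta>] endpoint_def by (cases \<sigma>) (auto simp: not_less)
  moreover have "card {r \<in> {r \<in> S (fst l) (snd l). \<not> heavy q \<theta> (endpoint \<sigma> (l, r))}. snd (endpoint \<sigma> (l, r)) = v}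
      \<le> card {r \<in> S (fst l) (snd l). snd (endpoint \<sigma> (l, r)) = v}"
    using finite_relation[of "fst l" "snd l"] l by (intro card_mono) auto
  ultimately show ?thesis by linarith
next
  case False
  then have "{r \<in> {r \<in> S (fst l) (snd l). \<not> heavy q \<theta> (endpoint \<sigma> (l, r))}. snd (endpoint \<sigma> (l, r)) = v} = {}"
    by blast
  moreover have "0 \<le> \<theta>" using \<theta> by (meson divide_nonneg_nonneg of_nat_0_le_iff order_trans)
  ultimately show ?thesis by (simp only: card.empty of_nat_0)
qed

lemma endpoint_edge:
  assumes "l \<in> clique_edges k"
  shows "fst (endpoint \<sigma> (l, r)) = (if \<sigma> then snd l else fst l)" "(if \<sigma> then snd l else fst l) \<in> {1..k}"
    "r \<in> S (fst l) (snd l) \<Longrightarrow> snd (endpoint \<sigma> (l, r)) \<in> {1..n}"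
  using clique_edgeD[of "fst l" "snd l"] relation[of "fst l" "snd l"] assms
  by (auto simp: endpoint_def mem_Times_iff)

text \<open>For one relation and one endpoint the event depends on a single uniform hash function,
  and \<open>bucket_tail\<close> applies with unit \<open>m / p\<close> and \<open>p\<close>
  buckets. The factors come from the relations, the two endpoints and the servers.\<close>

lemma prob_overloaded1:
  "measure_pmf.prob (hashes k p q) {h. overloaded1 k p q S T (fst h)}
     \<le> real (card (clique_edges k)) * (2 * (real p * exp (2 - T)))"
proof -
  have one: "measure_pmf.prob (hashes k p q) {h. T * (real m / real p) < real (card {r \<in> S (fst l) (snd l).
       \<not> Listed (endpoint \<sigma> (l, r)) \<and> case_prod (fst h) (endpoint \<sigma> (l, r)) = s})} \<le> exp (2 - T)"
    if l: "l \<in> clique_edges k" for l \<sigma> s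
  proof -
    define i where "i = (if \<sigma> then snd l else fst l)"
    let ?R = "{r \<in> S (fst l) (snd l). \<not> Listed (endpoint \<sigma> (l, r))}"
    have S: "finite (S (fst l) (snd l))" "card (S (fst l) (snd l)) = m"
      using finite_relation[of "fst l" "snd l"] relation[of "fst l" "snd l"] l by auto
    have marginal: "map_pmf (\<lambda>h. fst h i) (hashes k p q) = uniform_hash {1..n} p"
    proof -
      have "map_pmf (\<lambda>h. fst h i) (hashes k p q) = map_pmf (\<lambda>f. f i) (map_pmf fst (hashes k p q))"
        by (simp add: pmf.map_comp o_def)
      then show ?thesis
        using endpoint_edge(2)[OF l, of \<sigma>] by (simp add: hashes_def map_fst_pair_pmf Pi_pmf_component i_def)
    qed
    have "case_prod H (endpoint \<sigma> (l, r)) = H i (snd (endpoint \<sigma> (l, r)))" for H :: hash and r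
      using endpoint_edge(1)[OF l, of \<sigma> r] by (simp add: case_prod_unfold i_def)
    then have "{h. T * (real m / real p) < real (card {r \<in> S (fst l) (snd l).
         \<not> Listed (endpoint \<sigma> (l, r)) \<and> case_prod (fst h) (endpoint \<sigma> (l, r)) = s})}
      = (\<lambda>h. fst h i) -` {f. T * (real m / real p) < real (card {r \<in> ?R. f (snd (endpoint \<sigma> (l, r))) = s})}"
      by auto
    note event = this
    have "measure_pmf.prob (hashes k p q) {h. T * (real m / real p) < real (card {r \<in> S (fst l) (snd l).
         \<not> Listed (endpoint \<sigma> (l, r)) \<and> case_prod (fst h) (endpoint \<sigma> (l, r)) = s})}
      = measure_pmf.prob (uniform_hash {1..n} p)
          {f. T * (real m / real p) < real (card {r \<in> ?R. f (snd (endpoint \<sigma> (l, r))) = s})}"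
      unfolding marginal[symmetric] measure_map_pmf event ..
    also have "\<dots> \<le> exp (2 - T)"
    proof (rule bucket_tail)
      show "finite ?R" using S by simp
      show "(\<lambda>r. snd (endpoint \<sigma> (l, r))) ` ?R \<subseteq> {1..n}" using endpoint_edge(3)[OF l] by blast
      show "real (card {r \<in> ?R. snd (endpoint \<sigma> (l, r)) = v}) \<le> real m / real p" for v
        using light_fiber_le[OF l order_refl, of \<sigma> v] by (simp add: listed_def)
      have "card ?R \<le> m" using card_mono[of "S (fst l) (snd l)" ?R] S by auto
      then show "real (card ?R) \<le> real m / real p * real p" using p by simp
    qed (use p m in auto)
    finally show ?thesis .
  qed
  have two: "measure_pmf.prob (hashes k p q) {h. \<exists>\<sigma>\<in>UNIV. \<exists>s<p. T * (real m / real p) < real (card {r \<in> S (fst l) (snd l).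
       \<not> Listed (endpoint \<sigma> (l, r)) \<and> case_prod (fst h) (endpoint \<sigma> (l, r)) = s})}
       \<le> real (card (UNIV :: bool set)) * (real p * exp (2 - T))" if l: "l \<in> clique_edges k" for l
    by (intro prob_bex_le prob_ex_less_le one[OF l]) simp
  have "measure_pmf.prob (hashes k p q) {h. \<exists>l\<in>clique_edges k. \<exists>\<sigma>\<in>UNIV. \<exists>s<p. T * (real m / real p) < real (card {r \<in> S (fst l) (snd l).
       \<not> Listed (endpoint \<sigma> (l, r)) \<and> case_prod (fst h) (endpoint \<sigma> (l, r)) = s})}
       \<le> real (card (clique_edges k)) * (real (card (UNIV :: bool set)) * (real p * exp (2 - T)))"
    by (rule prob_bex_le[OF finite_clique_edges two])
  then show ?thesis unfolding overloaded1_def by (simp add: card_UNIV_bool)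
qed

text \<open>The two attributes of an edge differ, so their hash functions are independent and
  \<open>grid_tail\<close> applies to the light part of each relation.\<close>

lemma prob_overloaded2:
  assumes T: "1 \<le> T" and bm: "real (buckets k p) ^ 2 \<le> real m"
  shows "measure_pmf.prob (hashes k p q) {h. overloaded2 k p q S T (snd h)}
     \<le> real (card (clique_edges k)) * (3 * real (buckets k p) ^ 3 * exp (2 - T))"
proof -
  let ?b = "buckets k p"
  have one: "measure_pmf.prob (hashes k p q) {h. \<exists>\<alpha><?b. \<exists>\<beta><?b.
     4 * real k ^ 2 * T ^ 2 * real m / real ?b ^ 2 <
     real (card {r \<in> {r \<in> S (fst l) (snd l). \<forall>\<sigma>. \<not> Dense (endpoint \<sigma> (l, r))}.
       snd h (fst l) (fst r) = \<alpha> \<and> snd h (snd l) (snd r) = \<beta>})} \<le> 3 * real ?b ^ 3 * exp (2 - T)"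
    if l: "l \<in> clique_edges k" for l
  proof -
    let ?R = "{r \<in> S (fst l) (snd l). \<forall>\<sigma>. \<not> Dense (endpoint \<sigma> (l, r))}"
    let ?Q = "{(f, g). \<exists>\<alpha><?b. \<exists>\<beta><?b.
     4 * real k ^ 2 * T ^ 2 * real m / real ?b ^ 2 < real (card {r \<in> ?R. f (fst r) = \<alpha> \<and> g (snd r) = \<beta>})}"
    have S: "finite (S (fst l) (snd l))" "card (S (fst l) (snd l)) = m"
      "S (fst l) (snd l) \<subseteq> {1..n} \<times> {1..n}"
      using finite_relation[of "fst l" "snd l"] relation[of "fst l" "snd l"] l by auto
    have marginal: "map_pmf (\<lambda>h. (snd h (fst l), snd h (snd l))) (hashes k p q)
        = pair_pmf (uniform_hash {1..n} ?b) (uniform_hash {1..n} ?b)"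
    proof -
      have "map_pmf (\<lambda>h. (snd h (fst l), snd h (snd l))) (hashes k p q)
          = map_pmf (\<lambda>f. (f (fst l), f (snd l))) (map_pmf snd (hashes k p q))"
        by (simp add: pmf.map_comp o_def)
      also have "\<dots> = map_pmf (\<lambda>f. (f (fst l), f (snd l)))
          (Pi_pmf {1..k} (\<lambda>_. 0) (\<lambda>_. uniform_hash {1..n} ?b))"
        by (simp add: hashes_def map_snd_pair_pmf)
      also have "\<dots> = pair_pmf (uniform_hash {1..n} ?b) (uniform_hash {1..n} ?b)"
        using clique_edgeD[of "fst l" "snd l"] l by (subst map_pair_Pi_pmf) auto
      finally show ?thesis .
    qed
    have "measure_pmf.prob (hashes k p q) {h. \<exists>\<alpha><?b. \<exists>\<beta><?b.
       4 * real k ^ 2 * T ^ 2 * real m / real ?b ^ 2 <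
       real (card {r \<in> ?R. snd h (fst l) (fst r) = \<alpha> \<and> snd h (snd l) (snd r) = \<beta>})}
      = measure_pmf.prob (hashes k p q) ((\<lambda>h. (snd h (fst l), snd h (snd l))) -` ?Q)"
      by (intro arg_cong[where f = "measure_pmf.prob (hashes k p q)"]) auto
    also have "\<dots> = measure_pmf.prob (pair_pmf (uniform_hash {1..n} ?b) (uniform_hash {1..n} ?b)) ?Q"
      unfolding marginal[symmetric] measure_map_pmf by simp
    also have "\<dots> \<le> 3 * real ?b ^ 3 * exp (2 - T)"
    proof (rule grid_tail)
      have kp: "0 < k" "0 < p" using k p by auto
      show "0 < ?b" using buckets_pos(1)[OF kp] .
      \<comment> \<open>Density is measured against \<open>side k p\<close>, the grid bound against
        the smaller number of buckets.\<close>
      have "4 * real k ^ 2 * real m / real (side k p) \<le> 4 * real k ^ 2 * real m / real ?b"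
        using buckets_pos(1,2)[OF kp] by (intro divide_left_mono) auto
      moreover have "real (card {r \<in> ?R. snd (endpoint \<sigma> (l, r)) = v}) \<le> 4 * real k ^ 2 * real m / real (side k p)" for \<sigma> v
      proof -
        have "card {r \<in> ?R. snd (endpoint \<sigma> (l, r)) = v}
            \<le> card {r \<in> {r \<in> S (fst l) (snd l). \<not> Dense (endpoint \<sigma> (l, r))}. snd (endpoint \<sigma> (l, r)) = v}"
          using S(1) by (intro card_mono) auto
        then show ?thesis
          using light_fiber_le[OF l dense_threshold, of \<sigma> v] by (simp add: dense_def)
      qed
      ultimately have deg: "real (card {r \<in> ?R. snd (endpoint \<sigma> (l, r)) = v}) \<le> 4 * real k ^ 2 * real m / real ?b" for \<sigma> v
        by (rule order_trans[rotated])
      show "real (card {r \<in> ?R. fst r = v}) \<le> 4 * real k ^ 2 * real m / real ?b" for v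
        using deg[of False v] by (simp add: endpoint_def)
      show "real (card {r \<in> ?R. snd r = v}) \<le> 4 * real k ^ 2 * real m / real ?b" for v
        using deg[of True v] by (simp add: endpoint_def)
      have "card ?R \<le> m" using card_mono[of "S (fst l) (snd l)" ?R] S by auto
      then show "real (card ?R) \<le> real m" by simp
      have "1 \<le> real k ^ 2" using k by simp
      then show "1 \<le> 4 * real k ^ 2" by simp
    qed (use T bm S in auto)
    finally show ?thesis .
  qed
  show ?thesis
    unfolding overloaded2_def statistics by (rule prob_bex_le[OF finite_clique_edges one])
qed

section \<open>From buckets and item widths to the final load bound\<close>

lemma root_eq_powr: "root k (real p) ^ 2 = real p powr (2 / real k)"
proof -
  have "root k (real p) = real p powr (1 / real k)"
    using k by (simp add: root_powr_inverse)
  then show ?thesis by (simp add: power2_eq_square flip: powr_add)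
qed

text \<open>The floor of the root and the halving cost a factor 2 each, hence
  \<open>4 ^ 2 = 16\<close> after squaring.\<close>

lemma powr_le_buckets: "real p powr (2 / real k) \<le> 16 * real (buckets k p) ^ 2"
proof -
  have "root k (real p) \<le> 4 * real (buckets k p)"
    using root_le_side[of k p] buckets_pos(3)[of k p] k p by linarith
  then have "root k (real p) ^ 2 \<le> (4 * real (buckets k p)) ^ 2"
    by (intro power_mono real_root_ge_zero) auto
  then show ?thesis by (simp add: root_eq_powr power_mult_distrib)
qed

lemma powr_bounds: "1 \<le> real p powr (2 / real k)" "real p powr (2 / real k) \<le> real p"
proof -
  show "1 \<le> real p powr (2 / real k)" using p by (intro ge_one_powr_ge_zero) auto
  have "real p powr (2 / real k) \<le> real p powr 1" using p k by (intro powr_mono) auto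
  then show "real p powr (2 / real k) \<le> real p" using p by simp
qed

lemma m_le: "m \<le> n ^ 2"
proof -
  have "(1, 2) \<in> clique_edges k" using k by (simp add: clique_edges_def)
  then have "S 1 2 \<subseteq> {1..n} \<times> {1..n}" "card (S 1 2) = m" using relation by auto
  then show ?thesis
    using card_mono[of "{1..n} \<times> {1..n}" "S 1 2"] by (simp add: power2_eq_square)
qed

text \<open>Two distinct tuples need a domain with at least two values, so the logarithm is at least
  1 and absorbs the additive constants; \<open>5 + 2 * k \<le> 4 * k\<close> since
  \<open>3 \<le> k\<close>.\<close>

lemma item_width_le:
  assumes "2 \<le> m"
  shows "real (item_width k n) \<le> 4 * real k * log 2 (real n)"
proof -
  have "n \<ge> 2"
  proof (rule ccontr)
    assume "\<not> n \<ge> 2"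
    then have "n = 0 \<or> n = 1" by auto
    then show False using m_le assms by auto
  qed
  then have l: "1 \<le> log 2 (real n)" by (simp add: le_log_iff)
  have "real (nat \<lceil>log 2 (real n)\<rceil>) \<le> log 2 (real n) + 1" using l by linarith
  then have "real (item_width k n) \<le> 3 + 2 * real k + 2 * log 2 (real n)"
    unfolding item_width_def by simp
  also have "\<dots> \<le> (3 + 2 * real k) * log 2 (real n) + 2 * log 2 (real n)"
    using mult_left_mono[OF l, of "3 + 2 * real k"] by simp
  also have "\<dots> = (5 + 2 * real k) * log 2 (real n)" by (simp add: algebra_simps)
  also have "\<dots> \<le> 4 * real k * log 2 (real n)"
    using k l by (intro mult_right_mono) auto
  finally show ?thesis .
qed

end

lemma (in clique_run) load_bound:
  assumes T: "1 \<le> T" and p2: "2 \<le> p" and mp: "real p ^ 3 \<le> real m"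
    and ok: "\<not> overloaded1 k p q S T H" "\<not> overloaded2 k p q S T G"
  shows "real (load A p q D \<omega> (k - 1))
    \<le> 256 * real k ^ 7 * T ^ 2 * (size_in_bits n m / real p powr (2 / real k))"
proof -
  define P where "P = real p powr (2 / real k)"
  define X where "X = real m / P"
  have P: "1 \<le> P" "P \<le> real p" "P \<le> 16 * real (buckets k p) ^ 2"
    unfolding P_def using powr_bounds powr_le_buckets by auto
  have T2: "T \<le> T ^ 2" using T by (simp add: power2_eq_square)
  have X0: "0 \<le> X" unfolding X_def using P by simp
  have k1: "1 \<le> real k" using k by simp
  have K1: "real (card (K1 t)) \<le> 128 * real k ^ 6 * T ^ 2 * X" if "t < p" for t
  proof -
    \<comment> \<open>This is where the input has to be large: the broadcast of order
      \<open>p ^ 2\<close> is dominated by \<open>m / P\<close> because \<open>P \<le> p\<close> and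
      \<open>p ^ 3 \<le> m\<close>.\<close>
    have "real p ^ 2 * P \<le> real p ^ 2 * real p" using P by (intro mult_left_mono) auto
    also have "\<dots> \<le> real m" using mp by (simp add: power2_eq_square power3_eq_cube)
    finally have pX: "real p ^ 2 \<le> X" unfolding X_def using P by (simp add: field_simps)
    have mX: "real m / real p \<le> X" unfolding X_def using P p by (intro divide_left_mono) auto
    have "real (card (K1 t)) \<le> real k ^ 2 * (4 * real k ^ 4 * real p ^ 2 + 2 * (T * (real m / real p)))"
      by (rule card_K1[OF that ok(1)])
    also have "\<dots> \<le> real k ^ 2 * (4 * real k ^ 4 * (T ^ 2 * X) + 2 * real k ^ 4 * (T ^ 2 * X))"
    proof (intro mult_left_mono add_mono)
      have "1 * X \<le> T ^ 2 * X" using T T2 X0 by (intro mult_right_mono) auto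
      then show "real p ^ 2 \<le> T ^ 2 * X" using pX by simp
      have "T * (real m / real p) \<le> T ^ 2 * X" using T T2 mX by (intro mult_mono) auto
      moreover have "1 * (T ^ 2 * X) \<le> real k ^ 4 * (T ^ 2 * X)"
        using X0 k1 by (intro mult_right_mono) auto
      ultimately show "2 * (T * (real m / real p)) \<le> 2 * real k ^ 4 * (T ^ 2 * X)" by linarith
    qed auto
    also have "\<dots> = 6 * real k ^ 6 * (T ^ 2 * X)"
      by (simp add: algebra_simps power2_eq_square power_numeral_reduce)
    also have "\<dots> \<le> 128 * real k ^ 6 * (T ^ 2 * X)"
      using X0 by (intro mult_right_mono) auto
    finally show ?thesis by (simp add: mult_ac)
  qed
  have K2: "real (card (K2 t)) \<le> 128 * real k ^ 6 * T ^ 2 * X" for t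
  proof -
    have b: "0 < real (buckets k p)" using buckets_pos(1)[of k p] k p by simp
    have "real m / real (buckets k p) ^ 2 \<le> 16 * X"
    proof -
      have "P * real m \<le> 16 * real (buckets k p) ^ 2 * real m" using P by (intro mult_right_mono) auto
      then show ?thesis unfolding X_def using P b by (simp add: field_simps)
    qed
    then have "(8 * real k ^ 4 * T ^ 2) * (real m / real (buckets k p) ^ 2) \<le> (8 * real k ^ 4 * T ^ 2) * (16 * X)"
      by (intro mult_left_mono) auto
    moreover have "real k ^ 2 * (2 * (4 * real k ^ 2 * T ^ 2 * real m / real (buckets k p) ^ 2))
        = (8 * real k ^ 4 * T ^ 2) * (real m / real (buckets k p) ^ 2)"
      by (simp add: power2_eq_square power4_eq_xxxx)
    moreover have "128 * T ^ 2 * X * real k ^ 4 \<le> 128 * T ^ 2 * X * real k ^ 6"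
      using X0 k1 by (intro mult_left_mono power_increasing) auto
    ultimately show ?thesis using card_K2[OF ok(2), of t] by (simp add: mult_ac)
  qed
  have "2 \<le> m"
  proof -
    have "real p ^ 1 \<le> real p ^ 3" using p by (intro power_increasing) auto
    then have "real p \<le> real m" using mp by simp
    then show ?thesis using p2 by simp
  qed
  have "real (load A p q D \<omega> (k - 1)) \<le> real (item_width k n) * (128 * real k ^ 6 * T ^ 2 * X)"
    by (rule load_le[OF K1 K2])
  also have "\<dots> \<le> (4 * real k * log 2 (real n)) * (128 * real k ^ 6 * T ^ 2 * X)"
    using item_width_le[OF \<open>2 \<le> m\<close>] X0 by (intro mult_right_mono) auto
  \<comment> \<open>The product of 4 and 128 is halved because \<open>size_in_bits\<close> itself
    contains a factor 2.\<close>
  also have "\<dots> = 256 * real k ^ 7 * T ^ 2 * (size_in_bits n m / P)"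
    unfolding X_def size_in_bits_def by (simp add: power_numeral_reduce)
  finally show ?thesis unfolding P_def .
qed

text \<open>With \<open>T = 5 * ln p\<close> a single tail is \<open>exp 2 / p ^ 5\<close>, while
  the union bound has at most \<open>5 * k ^ 2 * p ^ 4\<close> terms.\<close>

lemma (in clique_input) prob_overloaded:
  assumes p2: "2 \<le> p" and mp: "real p ^ 3 \<le> real m"
  shows "measure_pmf.prob (hashes k p q)
      {h. overloaded1 k p q S (5 * ln (real p)) (fst h) \<or> overloaded2 k p q S (5 * ln (real p)) (snd h)}
    \<le> 5 * real k ^ 2 * exp 2 / real p"
proof -
  let ?T = "5 * ln (real p)" and ?b = "buckets k p"
  have p0: "0 < real p" using p2 by simp
  have T: "1 \<le> ?T" using p2 by (rule five_ln_ge_1)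
  have bp: "real ?b \<le> real p"
    using buckets_pos(2)[of k p] side_le[of k p] k p by linarith
  have b2: "real ?b ^ 2 \<le> real m"
  proof -
    have "real ?b ^ 2 \<le> real p ^ 2" using bp by (intro power_mono) auto
    also have "\<dots> \<le> real p ^ 3" using p by (intro power_increasing) auto
    finally show ?thesis using mp by linarith
  qed
  have e: "exp (2 - ?T) = exp 2 / real p ^ 5"
    using p0 by (simp add: exp_diff exp_of_nat_mult[of 5 "ln (real p)", simplified])
  have "{h. overloaded1 k p q S ?T (fst h) \<or> overloaded2 k p q S ?T (snd h)}
      = {h. overloaded1 k p q S ?T (fst h)} \<union> {h. overloaded2 k p q S ?T (snd h)}" by auto
  then have "measure_pmf.prob (hashes k p q) {h. overloaded1 k p q S ?T (fst h) \<or> overloaded2 k p q S ?T (snd h)}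
      \<le> measure_pmf.prob (hashes k p q) {h. overloaded1 k p q S ?T (fst h)} +
        measure_pmf.prob (hashes k p q) {h. overloaded2 k p q S ?T (snd h)}"
    by (simp add: measure_Un_le)
  also have "\<dots> \<le> real (card (clique_edges k)) * (2 * (real p * exp (2 - ?T)))
      + real (card (clique_edges k)) * (3 * real ?b ^ 3 * exp (2 - ?T))"
    by (intro add_mono prob_overloaded1 prob_overloaded2 T b2)
  also have "\<dots> = real (card (clique_edges k)) * ((2 * real p + 3 * real ?b ^ 3) * exp (2 - ?T))"
    by (simp add: algebra_simps)
  also have "\<dots> \<le> real k ^ 2 * ((5 * real p ^ 4) * exp (2 - ?T))"
  proof (intro mult_mono mult_right_mono)
    show "real (card (clique_edges k)) \<le> real k ^ 2"
      using card_clique_edges_le[of k] by (simp flip: of_nat_power)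
    have "real ?b ^ 3 \<le> real p ^ 3" using bp by (intro power_mono) auto
    also have "\<dots> \<le> real p ^ 4" using p by (intro power_increasing) auto
    finally have "real ?b ^ 3 \<le> real p ^ 4" .
    moreover have "real p \<le> real p ^ 4" using p by (intro self_le_power) auto
    ultimately show "2 * real p + 3 * real ?b ^ 3 \<le> 5 * real p ^ 4" by linarith
  qed auto
  also have "\<dots> = 5 * real k ^ 2 * exp 2 / real p"
    unfolding e using p0 by (simp add: field_simps power_numeral_reduce)
  finally show ?thesis .
qed

theorem lemma4p8:
  fixes k :: nat
  assumes "k \<ge> 3"
  shows "\<exists>(A :: (clique_statistics, labelled_tuple, nat \<Rightarrow> nat) mpc_algorithm)
            (c :: real) (C :: real) (d :: nat).
    c \<ge> 1 \<and>
    (\<forall>p n m S D. p \<ge> 1 \<and> real m \<ge> real p powr c \<and> clique_instance k n m S \<and>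
        evenly_partitioned p (input_tuples k S) D \<longrightarrow>
        (\<forall>\<omega> \<in> set_pmf (randomness A p (statistics_of k p n m S)).
           union_of_outputs A p (statistics_of k p n m S) D \<omega> (k - 1) = clique_answers k n S)) \<and>
    (\<forall>\<delta>>0. \<forall>\<^sub>F p in sequentially. \<forall>n m S D.
        real m \<ge> real p powr c \<and> clique_instance k n m S \<and>
        evenly_partitioned p (input_tuples k S) D \<longrightarrow>
        measure_pmf.prob (randomness A p (statistics_of k p n m S))
          {\<omega>. real (load A p (statistics_of k p n m S) D \<omega> (k - 1))
                \<le> C * log 2 (real p) ^ d * (size_in_bits n m / real p powr (2 / real k))}
          \<ge> 1 - \<delta>)"
\<comment> \<open>The exponent 3 gives \<open>p ^ 3 \<le> m\<close>. As \<open>T = 5 * ln p\<close>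
  is at most \<open>5 * log 2 p\<close>, the factor \<open>T ^ 2\<close> yields the logarithmic
  power 2 and the constant \<open>6400 = 256 * 25\<close>.\<close>
proof (rule exI[of _ "two_round_join k"], rule exI[of _ 3], rule exI[of _ "6400 * real k ^ 7"],
    rule exI[of _ 2], intro conjI allI impI ballI)
  let ?A = "two_round_join k"
  have seeds: "randomness ?A p q = map_pmf (to_nat_on (set_pmf (hashes k p q))) (hashes k p q)" for p q
    by (simp add: two_round_join_def)
  have m_pos: "1 \<le> m" if "1 \<le> p" "real p powr 3 \<le> real m" for p m :: nat
  proof -
    have "1 \<le> real p powr 3" using that(1) by (intro ge_one_powr_ge_zero) auto
    then show ?thesis using that(2) by linarith
  qed
  show "1 \<le> (3 :: real)" by simp
  {
    fix p n m :: nat and S D \<omega>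
    let ?q = "statistics_of k p n m S"
    assume *: "1 \<le> p \<and> real p powr 3 \<le> real m \<and> clique_instance k n m S \<and>
        evenly_partitioned p (input_tuples k S) D" and "\<omega> \<in> set_pmf (randomness ?A p ?q)"
    then obtain H G where HG: "(H, G) \<in> set_pmf (hashes k p ?q)" "\<omega> = to_nat_on (set_pmf (hashes k p ?q)) (H, G)"
      unfolding seeds by auto
    interpret clique_run k p n m S D H G
      using assms * m_pos[of p m] HG(1) by unfold_locales blast+
    show "union_of_outputs ?A p ?q D \<omega> (k - 1) = clique_answers k n S"
      unfolding HG(2) by (rule union_of_outputs_eq)
  }
  fix \<delta> :: real assume "0 < \<delta>"
  \<comment> \<open>From this point on the failure probability is at most \<open>\<delta>\<close>,
    uniformly in the input.\<close>
  have "\<forall>\<^sub>F p in sequentially. 5 * real k ^ 2 * exp 2 / \<delta> \<le> real p"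
    by (rule eventually_sequentiallyI[of "nat \<lceil>5 * real k ^ 2 * exp 2 / \<delta>\<rceil>"]) linarith
  then show "\<forall>\<^sub>F p in sequentially. \<forall>n m S D.
      real p powr 3 \<le> real m \<and> clique_instance k n m S \<and> evenly_partitioned p (input_tuples k S) D \<longrightarrow>
      1 - \<delta> \<le> measure_pmf.prob (randomness ?A p (statistics_of k p n m S))
        {\<omega>. real (load ?A p (statistics_of k p n m S) D \<omega> (k - 1))
              \<le> 6400 * real k ^ 7 * log 2 (real p) ^ 2 * (size_in_bits n m / real p powr (2 / real k))}"
    using eventually_ge_at_top[of 2]
  proof eventually_elim
    case (elim p)
    show ?case
    proof (intro allI impI)
      fix n m :: nat and S D
      assume *: "real p powr 3 \<le> real m \<and> clique_instance k n m S \<and> evenly_partitioned p (input_tuples k S) D"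
      let ?q = "statistics_of k p n m S" and ?T = "5 * ln (real p)"
      let ?bound = "6400 * real k ^ 7 * log 2 (real p) ^ 2 * (size_in_bits n m / real p powr (2 / real k))"
      let ?M = "hashes k p ?q"
      have p_ge: "1 \<le> p" "2 \<le> p" using elim by auto
      have mp: "real p ^ 3 \<le> real m" using * p_ge by (simp add: powr_numeral)
      interpret clique_input k p n m S
        using assms * m_pos[of p m] p_ge by unfold_locales blast+
      let ?bad = "{h. overloaded1 k p ?q S ?T (fst h) \<or> overloaded2 k p ?q S ?T (snd h)}"
      \<comment> \<open>Intersecting with the support is needed because only there does the seed
        determine the hash functions.\<close>
      have "(- ?bad) \<inter> set_pmf ?M \<subseteq>
        to_nat_on (set_pmf ?M) -` {\<omega>. real (load ?A p ?q D \<omega> (k - 1)) \<le> ?bound}"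
      proof
        fix h assume h: "h \<in> (- ?bad) \<inter> set_pmf ?M"
        obtain H G where HG: "h = (H, G)" by (cases h)
        interpret clique_run k p n m S D H G
          using * h HG by unfold_locales auto
        have "real (load ?A p ?q D \<omega> (k - 1)) \<le> 256 * real k ^ 7 * ?T ^ 2 * (size_in_bits n m / real p powr (2 / real k))"
          using h HG p_ge mp by (intro load_bound five_ln_ge_1) auto
        also have "\<dots> \<le> 256 * real k ^ 7 * (5 * log 2 (real p)) ^ 2 * (size_in_bits n m / real p powr (2 / real k))"
        proof (intro mult_right_mono mult_left_mono)
          have "0 \<le> ln (real p)" using p_ge by simp
          then have "ln (real p) * ln 2 \<le> ln (real p) * 1"
            using ln_le_minus_one[of 2] by (intro mult_left_mono) auto
          then have "5 * ln (real p) \<le> 5 * log 2 (real p)"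
            by (simp add: log_def field_simps)
          then show "?T ^ 2 \<le> (5 * log 2 (real p)) ^ 2"
            using p_ge by (intro power_mono) auto
          have "1 \<le> n" using m_le m by (cases n) auto
          then show "0 \<le> size_in_bits n m / real p powr (2 / real k)"
            by (simp add: size_in_bits_def)
        qed simp
        also have "\<dots> = ?bound" by (simp add: power_mult_distrib)
        finally show "h \<in> to_nat_on (set_pmf ?M) -` {\<omega>. real (load ?A p ?q D \<omega> (k - 1)) \<le> ?bound}"
          using HG by simp
      qed
      then have "measure_pmf.prob ?M ((- ?bad) \<inter> set_pmf ?M)
          \<le> measure_pmf.prob (randomness ?A p ?q) {\<omega>. real (load ?A p ?q D \<omega> (k - 1)) \<le> ?bound}"
        unfolding seeds measure_map_pmf by (intro measure_pmf.finite_measure_mono) auto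
      moreover have "measure_pmf.prob ?M ((- ?bad) \<inter> set_pmf ?M) = 1 - measure_pmf.prob ?M ?bad"
        unfolding measure_Int_set_pmf using measure_pmf.prob_compl[of ?bad ?M] by (simp add: Compl_eq_Diff_UNIV)
      moreover have "5 * real k ^ 2 * exp 2 / real p \<le> \<delta>"
        using elim(1) \<open>0 < \<delta>\<close> p_ge by (simp add: field_simps)
      ultimately show "1 - \<delta> \<le> measure_pmf.prob (randomness ?A p ?q) {\<omega>. real (load ?A p ?q D \<omega> (k - 1)) \<le> ?bound}"
        using prob_overloaded[OF p_ge(2) mp] by linarith
    qed
  qed
qed

end
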